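(* Let $R$ be a finite Frobenius ring, $n$ a positive integer, and $C\leq R^n$ a left LCD code. Then $(C,+)$ is a direct summand of $(R^n,+)$ in the category of abelian groups.
   Context: Rings are associative with unity, not necessarily commutative. A left code of length $n$ over $R$ is a left $R$-submodule of $R^n$. For $x,y\in R^n$ put $xy:=\sum_{i=1}^n x_iy_i$. For a left code $C\le R^n$, $C^\perp:=\{s\in R^n\mid cs=0\text{ for all }c\in C\}$, and $C$ is a left LCD code if $C\cap C^\perp=0$. Frobenius rings: Let $R$ be a semiperfect ring (e.g. a finite ring) with Jacobson radical $J(R)$, and let $e_1,\dots,e_m$ be a complete set of pairwise orthogonal primitive idempotents, ordered so that for some $k\le m$ the modules $e_1R,\dots,e_kR$ are pairwise non-isomorphic and for each $k<i\le m$ there is $j\le k$ with $e_iR\cong e_jR$ (equivalently $Re_i\cong Re_j$). For a module $M$, $\mathrm{top}(M)$ is $M$ modulo its radical, so $\mathrm{top}(e_iR)=e_iR/e_iJ(R)$, $\mathrm{top}(Re_i)=Re_i/J(R)e_i$; $\mathrm{soc}$ denotes the socle. For $i\le k$ let $V_i:=\mathrm{top}(e_iR)$, and let the multiplicity $\mu_i$ be the number of copies of $V_i$ in a decomposition of the right module $\mathrm{top}(R)=R/J(R)$ into simple modules. A permutation $\pi$ of $\{1,\dots,k\}$ is a Nakayama permutation if for all $i\le k$: $\mathrm{soc}(e_iR)\cong \mathrm{top}(e_{\pi(i)}R)$ and $\mathrm{soc}(Re_{\pi(i)})\cong\mathrm{top}(Re_i)$. A ring is quasi-Frobenius (QF)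 if it is (left and right) Artinian and has a Nakayama permutation. A ring is Frobenius if it is QF and its Nakayama permutation preserves multiplicities, i.e. $\mu_i=\mu_{\pi(i)}$ for all $i\le k$. *)

theory Defs
  imports "HOL-Algebra.Module" "HOL-Algebra.AbelCoset" "HOL-Combinatorics.Permutations"
begin

text \<open>
  Modules over a not necessarily commutative ring are represented by the library's
  \<^type>\<open>module_scheme\<close> records; the locale \<^locale>\<open>submodule\<close> does not presuppose commutativity, in
  contrast to \<^locale>\<open>module\<close>. All notions below are stated for left modules. A right \<open>R\<close>-module
  is treated as a left module over the opposite ring, so that, e.g., \<open>principal_module R e\<close> is
  the left module \<open>Re\<close> and \<open>principal_module (opp_ring R) e\<close> is the right module \<open>eR\<close>.
\<close>

definition opp_ring :: "('a, 'r) ring_scheme \<Rightarrow> ('a, 'r) ring_scheme"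
  where "opp_ring R = R\<lparr>monoid.mult := (\<lambda>x y. y \<otimes>\<^bsub>R\<^esub> x)\<rparr>"

text \<open>The multiplicative fields of a module record carry no meaning.\<close>

definition regular_module :: "('a, 'r) ring_scheme \<Rightarrow> ('a, 'a) module"
  where "regular_module R =
    \<lparr>carrier = carrier R, monoid.mult = undefined, one = undefined,
     zero = \<zero>\<^bsub>R\<^esub>, add = (\<oplus>\<^bsub>R\<^esub>), smult = (\<otimes>\<^bsub>R\<^esub>)\<rparr>"

definition principal_module :: "('a, 'r) ring_scheme \<Rightarrow> 'a \<Rightarrow> ('a, 'a) module"
  where "principal_module R e =
    (regular_module R)\<lparr>carrier := {r \<otimes>\<^bsub>R\<^esub> e | r. r \<in> carrier R}\<rparr>"

definition quot_module :: "('a, 'b, 'm) module_scheme \<Rightarrow> 'b set \<Rightarrow> ('a, 'b set) module"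
  where "quot_module M N =
    \<lparr>carrier = a_rcosets\<^bsub>M\<^esub> N, monoid.mult = undefined, one = undefined,
     zero = N, add = set_add M,
     smult = (\<lambda>r X. \<Union>x\<in>X. N +>\<^bsub>M\<^esub> (r \<odot>\<^bsub>M\<^esub> x))\<rparr>"

definition module_iso ::
    "('a, 'r) ring_scheme \<Rightarrow> ('a, 'b, 'm) module_scheme \<Rightarrow> ('a, 'c, 'n) module_scheme \<Rightarrow> bool"
  where "module_iso R M N \<longleftrightarrow>
    (\<exists>f \<in> iso (add_monoid M) (add_monoid N).
       \<forall>r \<in> carrier R. \<forall>x \<in> carrier M. f (r \<odot>\<^bsub>M\<^esub> x) = r \<odot>\<^bsub>N\<^esub> f x)"

definition simple_module :: "('a, 'r) ring_scheme \<Rightarrow> ('a, 'b, 'm) module_scheme \<Rightarrow> bool"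
  where "simple_module R M \<longleftrightarrow>
    carrier M \<noteq> {\<zero>\<^bsub>M\<^esub>} \<and> (\<forall>N. submodule N R M \<longrightarrow> N = {\<zero>\<^bsub>M\<^esub>} \<or> N = carrier M)"

definition simple_submodule ::
    "'b set \<Rightarrow> ('a, 'r) ring_scheme \<Rightarrow> ('a, 'b, 'm) module_scheme \<Rightarrow> bool"
  where "simple_submodule S R M \<longleftrightarrow> submodule S R M \<and> simple_module R (M\<lparr>carrier := S\<rparr>)"

definition maximal_submodule ::
    "'b set \<Rightarrow> ('a, 'r) ring_scheme \<Rightarrow> ('a, 'b, 'm) module_scheme \<Rightarrow> bool"
  where "maximal_submodule N R M \<longleftrightarrow>
    submodule N R M \<and> N \<noteq> carrier M \<and>
    (\<forall>N'. submodule N' R M \<and> N \<subseteq> N' \<longrightarrow> N' = N \<or> N' = carrier M)"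

definition module_radical :: "('a, 'r) ring_scheme \<Rightarrow> ('a, 'b, 'm) module_scheme \<Rightarrow> 'b set"
  where "module_radical R M = carrier M \<inter> \<Inter> {N. maximal_submodule N R M}"

definition top_module ::
    "('a, 'r) ring_scheme \<Rightarrow> ('a, 'b, 'm) module_scheme \<Rightarrow> ('a, 'b set) module"
  where "top_module R M = quot_module M (module_radical R M)"

text \<open>The sum of all simple submodules, as the least submodule containing them.\<close>

definition soc_module ::
    "('a, 'r) ring_scheme \<Rightarrow> ('a, 'b, 'm) module_scheme \<Rightarrow> ('a, 'b, 'm) module_scheme"
  where "soc_module R M =
    M\<lparr>carrier := \<Inter> {N. submodule N R M \<and> (\<forall>S. simple_submodule S R M \<longrightarrow> S \<subseteq> N)}\<rparr>"

text \<open>\<open>M\<close> is the internal direct sum of the simple submodules \<open>S 0, \<dots>, S (l - 1)\<close>.\<close>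

definition simple_decomposition ::
    "('a, 'r) ring_scheme \<Rightarrow> ('a, 'b, 'm) module_scheme \<Rightarrow> nat \<Rightarrow> (nat \<Rightarrow> 'b set) \<Rightarrow> bool"
  where "simple_decomposition R M l S \<longleftrightarrow>
    (\<forall>j<l. simple_submodule (S j) R M) \<and>
    bij_betw (\<lambda>s. \<Oplus>\<^bsub>M\<^esub>j\<in>{..<l}. s j) (\<Pi>\<^sub>E j\<in>{..<l}. S j) (carrier M)"

text \<open>
  The number of summands isomorphic to \<open>V\<close> in a decomposition of the semisimple module \<open>M\<close>; by
  Krull--Schmidt it does not depend on the decomposition.
\<close>

definition multiplicity_in ::
    "('a, 'r) ring_scheme \<Rightarrow> ('a, 'b, 'm) module_scheme \<Rightarrow> ('a, 'c, 'n) module_scheme \<Rightarrow> nat"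
  where "multiplicity_in R M V =
    (SOME c. \<exists>l S. simple_decomposition R M l S \<and>
       c = card {j. j < l \<and> module_iso R (M\<lparr>carrier := S j\<rparr>) V})"

definition idempotent_in :: "('a, 'r) ring_scheme \<Rightarrow> 'a \<Rightarrow> bool"
  where "idempotent_in R e \<longleftrightarrow> e \<in> carrier R \<and> e \<otimes>\<^bsub>R\<^esub> e = e"

definition orthogonal_in :: "('a, 'r) ring_scheme \<Rightarrow> 'a \<Rightarrow> 'a \<Rightarrow> bool"
  where "orthogonal_in R e f \<longleftrightarrow> e \<otimes>\<^bsub>R\<^esub> f = \<zero>\<^bsub>R\<^esub> \<and> f \<otimes>\<^bsub>R\<^esub> e = \<zero>\<^bsub>R\<^esub>"

definition primitive_idempotent :: "('a, 'r) ring_scheme \<Rightarrow> 'a \<Rightarrow> bool"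
  where "primitive_idempotent R e \<longleftrightarrow>
    idempotent_in R e \<and> e \<noteq> \<zero>\<^bsub>R\<^esub> \<and>
    (\<forall>f g. idempotent_in R f \<and> idempotent_in R g \<and> orthogonal_in R f g \<and> e = f \<oplus>\<^bsub>R\<^esub> g
       \<longrightarrow> f = \<zero>\<^bsub>R\<^esub> \<or> g = \<zero>\<^bsub>R\<^esub>)"

text \<open>
  Indices start at \<open>0\<close>: the idempotents are \<open>e 0, \<dots>, e (m - 1)\<close>, and the first \<open>k\<close> of them
  represent the isomorphism classes of the right modules \<open>e i R\<close>.
\<close>

definition ordered_primitive_idempotents ::
    "('a, 'r) ring_scheme \<Rightarrow> nat \<Rightarrow> nat \<Rightarrow> (nat \<Rightarrow> 'a) \<Rightarrow> bool"
  where "ordered_primitive_idempotents R m k e \<longleftrightarrow>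
    (\<forall>i<m. primitive_idempotent R (e i)) \<and>
    (\<forall>i<m. \<forall>j<m. i \<noteq> j \<longrightarrow> orthogonal_in R (e i) (e j)) \<and>
    (\<Oplus>\<^bsub>R\<^esub>i\<in>{..<m}. e i) = \<one>\<^bsub>R\<^esub> \<and>
    k \<le> m \<and>
    (\<forall>i<k. \<forall>j<k. i \<noteq> j \<longrightarrow>
       \<not> module_iso (opp_ring R)
           (principal_module (opp_ring R) (e i)) (principal_module (opp_ring R) (e j))) \<and>
    (\<forall>i. k \<le> i \<and> i < m \<longrightarrow> (\<exists>j<k.
       module_iso (opp_ring R)
         (principal_module (opp_ring R) (e i)) (principal_module (opp_ring R) (e j))))"

definition nakayama_permutation ::
    "('a, 'r) ring_scheme \<Rightarrow> nat \<Rightarrow> (nat \<Rightarrow> 'a) \<Rightarrow> (nat \<Rightarrow> nat) \<Rightarrow> bool"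
  where "nakayama_permutation R k e \<pi> \<longleftrightarrow>
    \<pi> permutes {..<k} \<and>
    (\<forall>i<k.
       module_iso (opp_ring R)
         (soc_module (opp_ring R) (principal_module (opp_ring R) (e i)))
         (top_module (opp_ring R) (principal_module (opp_ring R) (e (\<pi> i)))) \<and>
       module_iso R
         (soc_module R (principal_module R (e (\<pi> i))))
         (top_module R (principal_module R (e i))))"

text \<open>The multiplicity of \<open>top (eR)\<close> in the right module \<open>top R\<close>.\<close>

definition top_multiplicity :: "('a, 'r) ring_scheme \<Rightarrow> 'a \<Rightarrow> nat"
  where "top_multiplicity R e =
    multiplicity_in (opp_ring R)
      (top_module (opp_ring R) (regular_module (opp_ring R)))
      (top_module (opp_ring R) (principal_module (opp_ring R) e))"

definition left_artinian :: "('a, 'r) ring_scheme \<Rightarrow> bool"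
  where "left_artinian R \<longleftrightarrow>
    \<not> (\<exists>I :: nat \<Rightarrow> 'a set. \<forall>j. submodule (I j) R (regular_module R) \<and> I (Suc j) \<subset> I j)"

text \<open>
  Left Artinian rings are semiperfect, hence semiperfectness, which underlies the notion of a
  Nakayama permutation, is not listed separately.
\<close>

definition quasi_frobenius_ring :: "('a, 'r) ring_scheme \<Rightarrow> bool"
  where "quasi_frobenius_ring R \<longleftrightarrow>
    ring R \<and> left_artinian R \<and> left_artinian (opp_ring R) \<and>
    (\<exists>m k e \<pi>. ordered_primitive_idempotents R m k e \<and> nakayama_permutation R k e \<pi>)"

definition frobenius_ring :: "('a, 'r) ring_scheme \<Rightarrow> bool"
  where "frobenius_ring R \<longleftrightarrow>
    quasi_frobenius_ring R \<and>
    (\<exists>m k e \<pi>. ordered_primitive_idempotents R m k e \<and> nakayama_permutation R k e \<pi> \<and>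
       (\<forall>i<k. top_multiplicity R (e i) = top_multiplicity R (e (\<pi> i))))"

definition free_module :: "('a, 'r) ring_scheme \<Rightarrow> nat \<Rightarrow> ('a, nat \<Rightarrow> 'a) module"
  where "free_module R n =
    \<lparr>carrier = (\<Pi>\<^sub>E i\<in>{..<n}. carrier R), monoid.mult = undefined, one = undefined,
     zero = (\<lambda>i\<in>{..<n}. \<zero>\<^bsub>R\<^esub>),
     add = (\<lambda>x y. \<lambda>i\<in>{..<n}. x i \<oplus>\<^bsub>R\<^esub> y i),
     smult = (\<lambda>r x. \<lambda>i\<in>{..<n}. r \<otimes>\<^bsub>R\<^esub> x i)\<rparr>"

definition vec_prod :: "('a, 'r) ring_scheme \<Rightarrow> nat \<Rightarrow> (nat \<Rightarrow> 'a) \<Rightarrow> (nat \<Rightarrow> 'a) \<Rightarrow> 'a"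
  where "vec_prod R n x y = (\<Oplus>\<^bsub>R\<^esub>i\<in>{..<n}. x i \<otimes>\<^bsub>R\<^esub> y i)"

definition left_code :: "('a, 'r) ring_scheme \<Rightarrow> nat \<Rightarrow> (nat \<Rightarrow> 'a) set \<Rightarrow> bool"
  where "left_code R n C \<longleftrightarrow> submodule C R (free_module R n)"

definition dual_code :: "('a, 'r) ring_scheme \<Rightarrow> nat \<Rightarrow> (nat \<Rightarrow> 'a) set \<Rightarrow> (nat \<Rightarrow> 'a) set"
  where "dual_code R n C =
    {s \<in> carrier (free_module R n). \<forall>c\<in>C. vec_prod R n c s = \<zero>\<^bsub>R\<^esub>}"

definition left_lcd_code :: "('a, 'r) ring_scheme \<Rightarrow> nat \<Rightarrow> (nat \<Rightarrow> 'a) set \<Rightarrow> bool"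
  where "left_lcd_code R n C \<longleftrightarrow>
    left_code R n C \<and> C \<inter> dual_code R n C = {\<zero>\<^bsub>free_module R n\<^esub>}"

definition direct_summand :: "'b set \<Rightarrow> ('b, 'm) monoid_scheme \<Rightarrow> bool"
  where "direct_summand A G \<longleftrightarrow>
    subgroup A G \<and>
    (\<exists>B. subgroup B G \<and> A \<inter> B = {\<one>\<^bsub>G\<^esub>} \<and> A <#>\<^bsub>G\<^esub> B = carrier G)"

end

theory Submission
  imports Defs
begin

text \<open>
  The code \<open>C\<close> and its dual satisfy \<open>|R\<^sup>n| \<le> |C| |C\<^sup>\<bottom>|\<close>; if they intersect trivially, then \<open>C \<oplus> C\<^sup>\<bottom> = R\<^sup>n\<close>
  follows by counting. The inequality is proved by induction on \<open>C\<close>: for a maximal submodule \<open>C'\<close> of \<open>C\<close>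
  with simple quotient \<open>S\<close>, the group \<open>C'\<^sup>\<bottom> / C\<^sup>\<bottom>\<close> embeds into \<open>Hom(S, R)\<close>, and it remains to see that
  \<open>|Hom(S, R)| \<le> |S|\<close>. Let \<open>S \<cong> top (R e\<^sub>i)\<close> and \<open>q = |e\<^sub>i S|\<close>. Then \<open>|S|\<close> is \<open>q\<close> to the number of \<open>l\<close> with
  \<open>R e\<^sub>l \<cong> R e\<^sub>i\<close>, and \<open>|Hom(S, R)|\<close> is at most \<open>q\<close> to the number of \<open>l\<close> with \<open>soc (R e\<^sub>l) \<cong> S\<close>, which by the
  Nakayama permutation means \<open>R e\<^sub>l \<cong> R e\<^sub>\<pi>\<^sub>(\<^sub>i\<^sub>)\<close>. These numbers are the multiplicities of \<open>top (e\<^sub>i R)\<close> and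
  \<open>top (e\<^sub>\<pi>\<^sub>(\<^sub>i\<^sub>) R)\<close> in \<open>top R\<close>, so they agree in a Frobenius ring.
\<close>

subsection \<open>Left modules over a noncommutative ring\<close>

text \<open>The dual of a left code is stable under right multiplication, in general not under left
  multiplication. The complement it provides is therefore one of abelian groups, and sizes are
  compared instead of module homomorphisms. Two one-sided bounds suffice: |S| from below and |Hom(S,
  R)| from above.

  The main obstacle is a change of sides. Codes and the socle isomorphism used for Hom(S, R) concern
  left modules, whereas multiplicities are taken in the right module top R. The bridge is
  \<open>equiv_idem\<close>, a left-right symmetric condition on idempotents: through it a
  multiplicity becomes the size of an equivalence class of the \<open>e i\<close>, the same on both
  sides.

  The facts on simple modules and tops rest on one property of a primitive idempotent e of a finite
  ring: for z in eRe, one of z and e - z has e as a left multiple. Modules are compared through the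
  subgroups eM. Their sizes are invariant under isomorphism and multiplicative over direct sums,
  which also settles that \<open>multiplicity_in\<close>, defined by an arbitrary choice, is well
  defined.\<close>

locale left_module = R?: ring R + M?: abelian_group M for R (structure) and M (structure) +
  assumes smult_closed [simp, intro]:
      "\<lbrakk>a \<in> carrier R; x \<in> carrier M\<rbrakk> \<Longrightarrow> a \<odot>\<^bsub>M\<^esub> x \<in> carrier M"
    and smult_l_distr:
      "\<lbrakk>a \<in> carrier R; b \<in> carrier R; x \<in> carrier M\<rbrakk> \<Longrightarrow>
      (a \<oplus> b) \<odot>\<^bsub>M\<^esub> x = a \<odot>\<^bsub>M\<^esub> x \<oplus>\<^bsub>M\<^esub> b \<odot>\<^bsub>M\<^esub> x"
    and smult_r_distr:
      "\<lbrakk>a \<in> carrier R; x \<in> carrier M; y \<in> carrier M\<rbrakk> \<Longrightarrow>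
      a \<odot>\<^bsub>M\<^esub> (x \<oplus>\<^bsub>M\<^esub> y) = a \<odot>\<^bsub>M\<^esub> x \<oplus>\<^bsub>M\<^esub> a \<odot>\<^bsub>M\<^esub> y"
    and smult_assoc:
      "\<lbrakk>a \<in> carrier R; b \<in> carrier R; x \<in> carrier M\<rbrakk> \<Longrightarrow>
      (a \<otimes> b) \<odot>\<^bsub>M\<^esub> x = a \<odot>\<^bsub>M\<^esub> (b \<odot>\<^bsub>M\<^esub> x)"
    and smult_one [simp]: "x \<in> carrier M \<Longrightarrow> \<one> \<odot>\<^bsub>M\<^esub> x = x"

context left_module
begin

lemma smult_l_null [simp]: "x \<in> carrier M \<Longrightarrow> \<zero> \<odot>\<^bsub>M\<^esub> x = \<zero>\<^bsub>M\<^esub>"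
  using smult_l_distr[of \<zero> \<zero> x] by (metis M.add.r_cancel_one' R.l_zero R.zero_closed smult_closed)

lemma smult_r_null [simp]: "a \<in> carrier R \<Longrightarrow> a \<odot>\<^bsub>M\<^esub> \<zero>\<^bsub>M\<^esub> = \<zero>\<^bsub>M\<^esub>"
  using smult_r_distr[of a "\<zero>\<^bsub>M\<^esub>" "\<zero>\<^bsub>M\<^esub>"]
  by (metis M.add.r_cancel_one' M.l_zero M.zero_closed smult_closed)

lemma smult_l_minus:
  assumes "a \<in> carrier R" "x \<in> carrier M"
  shows "(\<ominus> a) \<odot>\<^bsub>M\<^esub> x = \<ominus>\<^bsub>M\<^esub> (a \<odot>\<^bsub>M\<^esub> x)"
proof -
  have "(\<ominus> a) \<odot>\<^bsub>M\<^esub> x \<oplus>\<^bsub>M\<^esub> a \<odot>\<^bsub>M\<^esub> x = \<zero>\<^bsub>M\<^esub>"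
    using assms smult_l_distr[of "\<ominus> a" a x] by (simp add: R.l_neg)
  then show ?thesis
    using assms M.minus_equality by (metis R.a_inv_closed smult_closed)
qed

lemma smult_diff_l:
  "\<lbrakk>a \<in> carrier R; b \<in> carrier R; x \<in> carrier M\<rbrakk> \<Longrightarrow>
    (a \<ominus> b) \<odot>\<^bsub>M\<^esub> x = a \<odot>\<^bsub>M\<^esub> x \<ominus>\<^bsub>M\<^esub> b \<odot>\<^bsub>M\<^esub> x"
  by (simp add: R.minus_eq M.minus_eq smult_l_distr smult_l_minus)

lemma smult_finsum:
  "\<lbrakk>finite A; a \<in> carrier R; f \<in> A \<rightarrow> carrier M\<rbrakk> \<Longrightarrow>
    a \<odot>\<^bsub>M\<^esub> (\<Oplus>\<^bsub>M\<^esub>i\<in>A. f i) = (\<Oplus>\<^bsub>M\<^esub>i\<in>A. a \<odot>\<^bsub>M\<^esub> f i)"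
  by (induct set: finite) (auto simp: Pi_def smult_r_distr)

lemma finsum_smult:
  "\<lbrakk>finite A; x \<in> carrier M; f \<in> A \<rightarrow> carrier R\<rbrakk> \<Longrightarrow>
    (\<Oplus>\<^bsub>R\<^esub>i\<in>A. f i) \<odot>\<^bsub>M\<^esub> x = (\<Oplus>\<^bsub>M\<^esub>i\<in>A. f i \<odot>\<^bsub>M\<^esub> x)"
  by (induct set: finite) (auto simp: Pi_def smult_l_distr)

text \<open>Closure under negation follows from - x = (- 1) x, so only sums and scalar multiples
  have to be checked.\<close>

lemma submoduleI:
  assumes "H \<subseteq> carrier M" "\<zero>\<^bsub>M\<^esub> \<in> H"
    and "\<And>a b. \<lbrakk>a \<in> H; b \<in> H\<rbrakk> \<Longrightarrow> a \<oplus>\<^bsub>M\<^esub> b \<in> H"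
    and "\<And>a x. \<lbrakk>a \<in> carrier R; x \<in> H\<rbrakk> \<Longrightarrow> a \<odot>\<^bsub>M\<^esub> x \<in> H"
  shows "submodule H R M"
proof -
  have "\<ominus>\<^bsub>M\<^esub> a \<in> H" if "a \<in> H" for a
    using that assms smult_l_minus[of \<one> a] by (metis R.a_inv_closed R.one_closed smult_one subsetD)
  then show ?thesis
    using assms by (intro submodule.intro subgroup.intro) (auto simp: submodule_axioms_def a_inv_def)
qed

lemma submoduleD:
  assumes "submodule H R M"
  shows "H \<subseteq> carrier M" "\<zero>\<^bsub>M\<^esub> \<in> H"
    and "\<And>a b. \<lbrakk>a \<in> H; b \<in> H\<rbrakk> \<Longrightarrow> a \<oplus>\<^bsub>M\<^esub> b \<in> H"
    and "\<And>a x. \<lbrakk>a \<in> carrier R; x \<in> H\<rbrakk> \<Longrightarrow> a \<odot>\<^bsub>M\<^esub> x \<in> H"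
    and "\<And>a. a \<in> H \<Longrightarrow> \<ominus>\<^bsub>M\<^esub> a \<in> H"
    and "\<And>a b. \<lbrakk>a \<in> H; b \<in> H\<rbrakk> \<Longrightarrow> a \<ominus>\<^bsub>M\<^esub> b \<in> H"
proof -
  interpret submodule H R M by fact
  show "H \<subseteq> carrier M" using subset by simp
  show "\<zero>\<^bsub>M\<^esub> \<in> H" using one_closed by simp
  show add: "\<And>a b. \<lbrakk>a \<in> H; b \<in> H\<rbrakk> \<Longrightarrow> a \<oplus>\<^bsub>M\<^esub> b \<in> H" using m_closed by simp
  show "\<And>a x. \<lbrakk>a \<in> carrier R; x \<in> H\<rbrakk> \<Longrightarrow> a \<odot>\<^bsub>M\<^esub> x \<in> H" by (rule smult_closed)
  show inv: "\<And>a. a \<in> H \<Longrightarrow> \<ominus>\<^bsub>M\<^esub> a \<in> H"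
    using m_inv_closed by (simp add: a_inv_def)
  show "\<And>a b. \<lbrakk>a \<in> H; b \<in> H\<rbrakk> \<Longrightarrow> a \<ominus>\<^bsub>M\<^esub> b \<in> H"
    by (simp add: M.minus_eq add inv)
qed

lemma submodule_iff:
  "submodule H R M \<longleftrightarrow> H \<subseteq> carrier M \<and> \<zero>\<^bsub>M\<^esub> \<in> H \<and>
    (\<forall>a\<in>H. \<forall>b\<in>H. a \<oplus>\<^bsub>M\<^esub> b \<in> H) \<and> (\<forall>a\<in>carrier R. \<forall>x\<in>H. a \<odot>\<^bsub>M\<^esub> x \<in> H)"
  using submoduleI submoduleD by (smt (verit))

lemma submodule_carrier: "submodule (carrier M) R M"
  by (rule submoduleI) auto

lemma submodule_zero: "submodule {\<zero>\<^bsub>M\<^esub>} R M"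
  by (rule submoduleI) auto

lemma submodule_is_left_module:
  assumes "submodule H R M"
  shows "left_module R (M\<lparr>carrier := H\<rparr>)"
proof -
  note H = submoduleD[OF assms]
  note sub = subsetD[OF H(1)]
  have "abelian_group (M\<lparr>carrier := H\<rparr>)"
  proof (rule abelian_groupI)
    fix x assume "x \<in> carrier (M\<lparr>carrier := H\<rparr>)"
    then show "\<exists>y\<in>carrier (M\<lparr>carrier := H\<rparr>). y \<oplus>\<^bsub>M\<lparr>carrier := H\<rparr>\<^esub> x = \<zero>\<^bsub>M\<lparr>carrier := H\<rparr>\<^esub>"
      using H(5) sub by (auto intro!: bexI[of _ "\<ominus>\<^bsub>M\<^esub> x"] simp: M.l_neg)
  qed (auto simp: H(2,3) sub M.a_ac)
  then show ?thesis
    using H sub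
    by (intro left_module.intro left_module_axioms.intro)
      (auto simp: R.ring_axioms smult_l_distr smult_r_distr smult_assoc)
qed

lemma submodule_of_submodule_iff:
  assumes "submodule H R M"
  shows "submodule N R (M\<lparr>carrier := H\<rparr>) \<longleftrightarrow> submodule N R M \<and> N \<subseteq> H"
  using left_module.submodule_iff[OF submodule_is_left_module[OF assms], of N]
    submodule_iff[of N] submoduleD(1)[OF assms] by auto

lemma cyclic_submodule:
  assumes "x \<in> carrier M"
  shows "submodule {r \<odot>\<^bsub>M\<^esub> x | r. r \<in> carrier R} R M"
proof (rule submoduleI)
  show "\<zero>\<^bsub>M\<^esub> \<in> {r \<odot>\<^bsub>M\<^esub> x | r. r \<in> carrier R}"
    using smult_l_null[OF assms] by (metis (mono_tags, lifting) R.zero_closed mem_Collect_eq)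
  fix a b assume "a \<in> {r \<odot>\<^bsub>M\<^esub> x | r. r \<in> carrier R}" "b \<in> {r \<odot>\<^bsub>M\<^esub> x | r. r \<in> carrier R}"
  then show "a \<oplus>\<^bsub>M\<^esub> b \<in> {r \<odot>\<^bsub>M\<^esub> x | r. r \<in> carrier R}"
    using smult_l_distr[OF _ _ assms] by (smt (verit) R.a_closed mem_Collect_eq)
next
  fix a y assume "a \<in> carrier R" "y \<in> {r \<odot>\<^bsub>M\<^esub> x | r. r \<in> carrier R}"
  then show "a \<odot>\<^bsub>M\<^esub> y \<in> {r \<odot>\<^bsub>M\<^esub> x | r. r \<in> carrier R}"
    using smult_assoc[OF _ _ assms] by (smt (verit) R.m_closed mem_Collect_eq)
qed (use assms in auto)

lemma self_in_cyclic: "x \<in> carrier M \<Longrightarrow> x \<in> {r \<odot>\<^bsub>M\<^esub> x | r. r \<in> carrier R}"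
  using smult_one by force

lemma submodule_sum:
  assumes "submodule H R M" "submodule K R M"
  shows "submodule {h \<oplus>\<^bsub>M\<^esub> k | h k. h \<in> H \<and> k \<in> K} R M"
proof -
  note H = submoduleD[OF assms(1)] and K = submoduleD[OF assms(2)]
  note sH = subsetD[OF H(1)] and sK = subsetD[OF K(1)]
  show ?thesis
  proof (rule submoduleI)
    show "\<zero>\<^bsub>M\<^esub> \<in> {h \<oplus>\<^bsub>M\<^esub> k | h k. h \<in> H \<and> k \<in> K}"
      using H(2) K(2) M.l_zero[OF M.zero_closed] by force
    fix a b assume "a \<in> {h \<oplus>\<^bsub>M\<^esub> k | h k. h \<in> H \<and> k \<in> K}" "b \<in> {h \<oplus>\<^bsub>M\<^esub> k | h k. h \<in> H \<and> k \<in> K}"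
    then obtain h k h' k' where hk: "h \<in> H" "k \<in> K" "h' \<in> H" "k' \<in> K"
        "a = h \<oplus>\<^bsub>M\<^esub> k" "b = h' \<oplus>\<^bsub>M\<^esub> k'"
      by auto
    have "a \<oplus>\<^bsub>M\<^esub> b = (h \<oplus>\<^bsub>M\<^esub> h') \<oplus>\<^bsub>M\<^esub> (k \<oplus>\<^bsub>M\<^esub> k')"
      using hk sH sK by (simp add: M.a_ac)
    then show "a \<oplus>\<^bsub>M\<^esub> b \<in> {h \<oplus>\<^bsub>M\<^esub> k | h k. h \<in> H \<and> k \<in> K}"
      using hk H(3) K(3) by blast
  next
    fix a y assume a: "a \<in> carrier R" and "y \<in> {h \<oplus>\<^bsub>M\<^esub> k | h k. h \<in> H \<and> k \<in> K}"
    then obtain h k where hk: "h \<in> H" "k \<in> K" "y = h \<oplus>\<^bsub>M\<^esub> k" by auto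
    have "a \<odot>\<^bsub>M\<^esub> y = a \<odot>\<^bsub>M\<^esub> h \<oplus>\<^bsub>M\<^esub> a \<odot>\<^bsub>M\<^esub> k"
      using hk sH sK a by (simp add: smult_r_distr)
    then show "a \<odot>\<^bsub>M\<^esub> y \<in> {h \<oplus>\<^bsub>M\<^esub> k | h k. h \<in> H \<and> k \<in> K}"
      using hk H(4) K(4) a by blast
  qed (auto simp: sH sK)
qed

text \<open>A nonzero element spans a nonzero cyclic submodule, which simplicity forces to be
  everything. Later arguments use this elementwise form and not the quantification over
  submodules.\<close>

lemma simple_module_iff:
  "simple_module R M \<longleftrightarrow> carrier M \<noteq> {\<zero>\<^bsub>M\<^esub>} \<and>
    (\<forall>x\<in>carrier M - {\<zero>\<^bsub>M\<^esub>}. \<forall>y\<in>carrier M. \<exists>r\<in>carrier R. y = r \<odot>\<^bsub>M\<^esub> x)"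
proof (intro iffI conjI ballI)
  assume "simple_module R M"
  then show "carrier M \<noteq> {\<zero>\<^bsub>M\<^esub>}" by (simp add: simple_module_def)
  fix x y assume x: "x \<in> carrier M - {\<zero>\<^bsub>M\<^esub>}" and y: "y \<in> carrier M"
  have "{r \<odot>\<^bsub>M\<^esub> x | r. r \<in> carrier R} = carrier M"
  proof -
    have "{r \<odot>\<^bsub>M\<^esub> x | r. r \<in> carrier R} \<noteq> {\<zero>\<^bsub>M\<^esub>}"
      using self_in_cyclic[of x] x by auto
    then show ?thesis
      using \<open>simple_module R M\<close> cyclic_submodule[of x] x unfolding simple_module_def by blast
  qed
  then show "\<exists>r\<in>carrier R. y = r \<odot>\<^bsub>M\<^esub> x" using y by blast
next
  assume *: "carrier M \<noteq> {\<zero>\<^bsub>M\<^esub>} \<and>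
    (\<forall>x\<in>carrier M - {\<zero>\<^bsub>M\<^esub>}. \<forall>y\<in>carrier M. \<exists>r\<in>carrier R. y = r \<odot>\<^bsub>M\<^esub> x)"
  have "N = {\<zero>\<^bsub>M\<^esub>} \<or> N = carrier M" if "submodule N R M" for N
  proof (rule disjCI)
    note N = submoduleD[OF that]
    assume "N \<noteq> carrier M"
    show "N = {\<zero>\<^bsub>M\<^esub>}"
    proof (rule ccontr)
      assume "N \<noteq> {\<zero>\<^bsub>M\<^esub>}"
      then obtain x where "x \<in> N" "x \<noteq> \<zero>\<^bsub>M\<^esub>" using N(2) by auto
      then have x: "x \<in> carrier M - {\<zero>\<^bsub>M\<^esub>}" using N(1) by auto
      have "y \<in> N" if y: "y \<in> carrier M" for y
      proof -
        obtain r where "r \<in> carrier R" "y = r \<odot>\<^bsub>M\<^esub> x"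
          using conjunct2[OF *, rule_format, OF x y] by blast
        then show ?thesis using N(4) \<open>x \<in> N\<close> by simp
      qed
      then have "carrier M \<subseteq> N" by auto
      then show False using N(1) \<open>N \<noteq> carrier M\<close> by auto
    qed
  qed
  then show "simple_module R M" using * by (simp add: simple_module_def)
qed

lemma simple_module_generate:
  assumes "simple_module R M" "x \<in> carrier M" "x \<noteq> \<zero>\<^bsub>M\<^esub>" "y \<in> carrier M"
  obtains r where "r \<in> carrier R" "y = r \<odot>\<^bsub>M\<^esub> x"
  using assms unfolding simple_module_iff by blast

text \<open>Rx + N is a submodule strictly above \<open>N\<close>, so maximality makes it all of
  \<open>M\<close>.\<close>

lemma maximal_submodule_generate:
  assumes "maximal_submodule N R M" "x \<in> carrier M" "x \<notin> N" "y \<in> carrier M"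
  obtains r k where "r \<in> carrier R" "k \<in> N" "y = r \<odot>\<^bsub>M\<^esub> x \<oplus>\<^bsub>M\<^esub> k"
proof -
  let ?X = "{r \<odot>\<^bsub>M\<^esub> x | r. r \<in> carrier R}"
  let ?B = "{h \<oplus>\<^bsub>M\<^esub> k | h k. h \<in> ?X \<and> k \<in> N}"
  have N: "submodule N R M" using assms(1) by (simp add: maximal_submodule_def)
  note N' = submoduleD[OF N]
  have B: "submodule ?B R M"
    using submodule_sum[OF cyclic_submodule[OF assms(2)] N] .
  have "N \<subseteq> ?B"
  proof
    fix k assume k: "k \<in> N"
    have "\<zero>\<^bsub>M\<^esub> \<in> ?X" using submoduleD(2)[OF cyclic_submodule[OF assms(2)]] .
    moreover have "k = \<zero>\<^bsub>M\<^esub> \<oplus>\<^bsub>M\<^esub> k" using k N'(1) by auto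
    ultimately show "k \<in> ?B" using k by blast
  qed
  moreover have "x \<in> ?B"
  proof -
    have "x = x \<oplus>\<^bsub>M\<^esub> \<zero>\<^bsub>M\<^esub>" using assms(2) by simp
    then show ?thesis using self_in_cyclic[OF assms(2)] N'(2) by blast
  qed
  ultimately have "?B = carrier M"
    using assms(1,3) B unfolding maximal_submodule_def by blast
  then have "y \<in> ?B" using assms(4) by simp
  then show thesis using that by blast
qed

lemma exists_maximal_submodule:
  assumes "finite (carrier M)" "submodule N R M" "N \<noteq> carrier M"
  obtains N' where "maximal_submodule N' R M" "N \<subseteq> N'"
proof -
  let ?P = "{H. submodule H R M \<and> H \<noteq> carrier M}"
  have "finite ?P"
    by (rule finite_subset[of _ "Pow (carrier M)"]) (use assms(1) submoduleD(1) in auto)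
  then obtain N' where N': "N' \<in> ?P" "N \<subseteq> N'" "\<forall>H\<in>?P. N' \<subseteq> H \<longrightarrow> N' = H"
    using finite_has_maximal2[of ?P N] assms by auto
  then have "maximal_submodule N' R M"
    unfolding maximal_submodule_def by blast
  then show thesis using that N' by blast
qed

end

subsection \<open>Primitive idempotents of a finite ring\<close>

text \<open>By the pigeonhole principle two powers of \<open>x\<close> coincide, so from some
  exponent a on the powers are periodic with some period p. An exponent that is a multiple of p and
  at least a can be doubled without changing the power.\<close>

lemma (in monoid) finite_idempotent_power:
  assumes "finite (carrier G)" "x \<in> carrier G"
  obtains n :: nat where "n > 0" "x [^] n \<otimes> x [^] n = x [^] n"
proof -
  have "\<not> inj_on (\<lambda>n::nat. x [^] n) UNIV"
  proof
    assume "inj_on (\<lambda>n::nat. x [^] n) UNIV"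
    moreover have "finite (range (\<lambda>n::nat. x [^] n))"
      by (rule finite_subset[OF _ assms(1)]) (use assms(2) in auto)
    ultimately show False using finite_imageD by blast
  qed
  then obtain a b :: nat where "x [^] a = x [^] b" "a \<noteq> b"
    by (auto simp: inj_on_def)
  then obtain a p :: nat where ap: "x [^] a = x [^] (a + p)" "p > 0"
    by (metis add_diff_inverse_nat less_imp_le linorder_neqE_nat not_less zero_less_diff)
  have shift: "x [^] m = x [^] (m + p)" if "m \<ge> a" for m
  proof -
    have "x [^] m = x [^] a \<otimes> x [^] (m - a)"
      using that assms(2) by (simp add: nat_pow_mult)
    also have "\<dots> = x [^] (a + p) \<otimes> x [^] (m - a)" using ap by simp
    also have "\<dots> = x [^] (m + p)"
      using that assms(2) by (simp add: nat_pow_mult add.commute)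
    finally show ?thesis .
  qed
  have shifts: "x [^] m = x [^] (m + t * p)" if "m \<ge> a" for m t
  proof (induction t)
    case (Suc t)
    have "x [^] (m + Suc t * p) = x [^] ((m + t * p) + p)" by (simp add: algebra_simps)
    also have "\<dots> = x [^] (m + t * p)" using shift[of "m + t * p"] that by simp
    finally show ?case using Suc by simp
  qed simp
  \<comment> \<open>A multiple of the period that is at least \<open>a\<close>; the factor
    \<open>Suc a\<close> keeps it positive even for a = 0. Doubling it adds \<open>Suc a\<close>
    full periods.\<close>
  define n where "n = Suc a * p"
  have "n \<ge> a" using ap(2) by (cases p) (auto simp: n_def)
  moreover have "n > 0" using ap(2) by (simp add: n_def)
  ultimately show thesis
    using that[of n] shifts[of n "Suc a"] assms(2) by (simp add: n_def nat_pow_mult)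
qed

text \<open>This says \<open>Re \<cong> Rf\<close> as left modules and, equivalently, \<open>eR \<cong> fR\<close> as right modules.\<close>

definition equiv_idem :: "('a, 'r) ring_scheme \<Rightarrow> 'a \<Rightarrow> 'a \<Rightarrow> bool"
  where "equiv_idem R e f \<longleftrightarrow>
    (\<exists>a\<in>carrier R. \<exists>b\<in>carrier R. e \<otimes>\<^bsub>R\<^esub> a = a \<and> a \<otimes>\<^bsub>R\<^esub> f = a \<and> f \<otimes>\<^bsub>R\<^esub> b = b \<and> b \<otimes>\<^bsub>R\<^esub> e = b \<and>
       a \<otimes>\<^bsub>R\<^esub> b = e \<and> b \<otimes>\<^bsub>R\<^esub> a = f)"

lemma equiv_idem_sym: "equiv_idem R e f \<Longrightarrow> equiv_idem R f e"
  unfolding equiv_idem_def by blast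

lemma (in abelian_group) minus_eq_zero_iff:
  "\<lbrakk>x \<in> carrier G; y \<in> carrier G\<rbrakk> \<Longrightarrow> x \<ominus> y = \<zero> \<longleftrightarrow> x = y"
  using minus_equality[of x "\<ominus> y"] by (auto simp: minus_eq r_neg)

context ring
begin

lemma primitive_idempotentD:
  assumes "primitive_idempotent R e"
  shows "e \<in> carrier R" "e \<otimes> e = e" "e \<noteq> \<zero>"
  using assms by (auto simp: primitive_idempotent_def idempotent_in_def)

lemma equiv_idem_refl: "primitive_idempotent R e \<Longrightarrow> equiv_idem R e e"
  using primitive_idempotentD[of e] unfolding equiv_idem_def by blast

lemma equiv_idem_trans:
  assumes "equiv_idem R e f" "equiv_idem R f g"
    and "e \<in> carrier R" "f \<in> carrier R" "g \<in> carrier R"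
  shows "equiv_idem R e g"
proof -
  obtain a b where ab: "a \<in> carrier R" "b \<in> carrier R" "e \<otimes> a = a" "a \<otimes> f = a" "f \<otimes> b = b"
      "b \<otimes> e = b" "a \<otimes> b = e" "b \<otimes> a = f"
    using assms(1) unfolding equiv_idem_def by blast
  obtain c d where cd: "c \<in> carrier R" "d \<in> carrier R" "f \<otimes> c = c" "c \<otimes> g = c" "g \<otimes> d = d"
      "d \<otimes> f = d" "c \<otimes> d = f" "d \<otimes> c = g"
    using assms(2) unfolding equiv_idem_def by blast
  have "(a \<otimes> c) \<otimes> (d \<otimes> b) = a \<otimes> ((c \<otimes> d) \<otimes> b)"
    using ab(1,2) cd(1,2) by (simp add: m_assoc)
  then have 1: "(a \<otimes> c) \<otimes> (d \<otimes> b) = e" using ab cd by simp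
  have "(d \<otimes> b) \<otimes> (a \<otimes> c) = d \<otimes> ((b \<otimes> a) \<otimes> c)"
    using ab(1,2) cd(1,2) by (simp add: m_assoc)
  then have 2: "(d \<otimes> b) \<otimes> (a \<otimes> c) = g" using ab cd by simp
  have 3: "e \<otimes> (a \<otimes> c) = a \<otimes> c" "g \<otimes> (d \<otimes> b) = d \<otimes> b"
    using ab cd assms(3-) by (simp_all flip: m_assoc)
  have 4: "(a \<otimes> c) \<otimes> g = a \<otimes> c" "(d \<otimes> b) \<otimes> e = d \<otimes> b"
    using ab cd assms(3-) by (simp_all add: m_assoc)
  show ?thesis
    unfolding equiv_idem_def
    by (rule bexI[of _ "a \<otimes> c"], rule bexI[of _ "d \<otimes> b"]) (use 1 2 3 4 ab cd in auto)
qed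

text \<open>f = g + (f - g) splits \<open>f\<close> into orthogonal idempotents, one of which must
  vanish.\<close>

lemma primitive_idempotent_trivial:
  assumes "primitive_idempotent R f" "g \<in> carrier R" "g \<otimes> g = g" "f \<otimes> g = g" "g \<otimes> f = g"
  shows "g = \<zero> \<or> g = f"
proof -
  note f = primitive_idempotentD[OF assms(1)]
  have "(f \<ominus> g) \<otimes> (f \<ominus> g) = f \<ominus> g"
    using f assms(2-) by (simp add: minus_eq l_distr r_distr l_minus r_minus r_neg l_neg a_assoc)
  moreover have "g \<otimes> (f \<ominus> g) = \<zero>" "(f \<ominus> g) \<otimes> g = \<zero>"
    using f assms(2-) by (simp_all add: minus_eq l_distr r_distr l_minus r_minus r_neg)
  moreover have "f = g \<oplus> (f \<ominus> g)"
    using f assms(2) by (simp add: minus_eq a_lcomm r_neg)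
  ultimately have "g = \<zero> \<or> f \<ominus> g = \<zero>"
    using assms f unfolding primitive_idempotent_def idempotent_in_def orthogonal_in_def
    by (metis minus_closed)
  then show ?thesis using f assms(2) minus_eq_zero_iff[of f g] by auto
qed

text \<open>This is locality of the ring eRe. Some positive power of \<open>z\<close> is idempotent
  and lies in eRe, hence is 0 or e. If it is e, the preceding power of \<open>z\<close> is the
  required left factor; if it is 0, \<open>z\<close> is nilpotent and a finite geometric series
  inverts e - z.\<close>

lemma primitive_idempotent_local:
  assumes "finite (carrier R)" "primitive_idempotent R e"
    and z: "z \<in> carrier R" "e \<otimes> z = z" "z \<otimes> e = z"
  shows "(\<exists>u\<in>carrier R. u \<otimes> z = e) \<or> (\<exists>u\<in>carrier R. u \<otimes> (e \<ominus> z) = e)"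
proof -
  note e = primitive_idempotentD[OF assms(2)]
  obtain n :: nat where n: "n > 0" "z [^] n \<otimes> z [^] n = z [^] n"
    using finite_idempotent_power[OF assms(1) z(1)] .
  obtain k where k: "n = Suc k" using n(1) gr0_implies_Suc by blast
  have pow: "z [^] n = z \<otimes> z [^] k" "z [^] n = z [^] k \<otimes> z"
    using nat_pow_Suc2[OF z(1)] by (simp_all add: k)
  have "e \<otimes> (z \<otimes> z [^] k) = z \<otimes> z [^] k" "(z [^] k \<otimes> z) \<otimes> e = z [^] k \<otimes> z"
    using m_assoc[OF e(1) z(1), of "z [^] k"] m_assoc[OF _ z(1) e(1), of "z [^] k"] z by simp_all
  then have "e \<otimes> z [^] n = z [^] n" "z [^] n \<otimes> e = z [^] n"
    using pow by simp_all
  then consider "z [^] n = \<zero>" | "z [^] n = e"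
    using primitive_idempotent_trivial[OF assms(2), of "z [^] n"] n(2) z(1) by auto
  then show ?thesis
  proof cases
    case 1
    \<comment> \<open>The witness built by the induction is g = e + z + ... + z^m. At
      \<open>m = k\<close> the right-hand side is e - z^n = e.\<close>
    have "\<exists>g\<in>carrier R. g \<otimes> (e \<ominus> z) = e \<ominus> z [^] Suc m" for m
    proof (induction m)
      case 0
      show ?case by (rule bexI[of _ e]) (use z e in \<open>simp_all add: minus_eq r_distr r_minus\<close>)
    next
      case (Suc m)
      then obtain g where g: "g \<in> carrier R" "g \<otimes> (e \<ominus> z) = e \<ominus> z [^] Suc m" by blast
      have "(e \<oplus> z \<otimes> g) \<otimes> (e \<ominus> z) = (e \<ominus> z) \<oplus> z \<otimes> (g \<otimes> (e \<ominus> z))"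
        using g(1) z e by (simp add: l_distr m_assoc) (simp add: minus_eq r_distr r_minus)
      also have "\<dots> = (e \<ominus> z) \<oplus> (z \<ominus> z \<otimes> z [^] Suc m)"
        using z e by (simp only: g(2)) (simp add: minus_eq r_distr r_minus)
      also have "\<dots> = e \<ominus> z \<otimes> z [^] Suc m"
        using z e by (simp add: minus_eq a_assoc del: nat_pow_Suc) (simp add: a_assoc[symmetric] l_neg)
      also have "z \<otimes> z [^] Suc m = z [^] Suc (Suc m)"
        using z(1) nat_pow_Suc2[of z "Suc m"] by simp
      finally show ?case using g(1) z(1) e(1) by blast
    qed
    from this[of k] show ?thesis using 1 e(1) k by (auto simp: minus_eq)
  next
    case 2
    then show ?thesis using z(1) k nat_pow_closed[of z k] by (intro disjI1 bexI[of _ "z [^] k"]) simp_all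
  qed
qed

end

subsection \<open>Simple modules and idempotents\<close>

text \<open>For idempotent \<open>e\<close> this is the subgroup eM, in bijection with Hom(Re, M) by
  evaluation at \<open>e\<close>. For primitive \<open>e\<close> its size measures how often top(Re)
  occurs in M.\<close>

definition peirce :: "('a, 'b, 'm) module_scheme \<Rightarrow> 'a \<Rightarrow> 'b set"
  where "peirce M e = {x \<in> carrier M. e \<odot>\<^bsub>M\<^esub> x = x}"

lemma module_isoI:
  assumes "bij_betw f (carrier M) (carrier N)"
    and "\<And>x y. \<lbrakk>x \<in> carrier M; y \<in> carrier M\<rbrakk> \<Longrightarrow> f (x \<oplus>\<^bsub>M\<^esub> y) = f x \<oplus>\<^bsub>N\<^esub> f y"
    and "\<And>r x. \<lbrakk>r \<in> carrier R; x \<in> carrier M\<rbrakk> \<Longrightarrow> f (r \<odot>\<^bsub>M\<^esub> x) = r \<odot>\<^bsub>N\<^esub> f x"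
  shows "module_iso R M N"
  using assms bij_betwE[OF assms(1)] unfolding module_iso_def iso_def hom_def
  by (intro bexI[of _ f]) auto

lemma module_isoD:
  assumes "module_iso R M N"
  obtains f where "bij_betw f (carrier M) (carrier N)"
    and "\<And>x y. \<lbrakk>x \<in> carrier M; y \<in> carrier M\<rbrakk> \<Longrightarrow> f (x \<oplus>\<^bsub>M\<^esub> y) = f x \<oplus>\<^bsub>N\<^esub> f y"
    and "\<And>r x. \<lbrakk>r \<in> carrier R; x \<in> carrier M\<rbrakk> \<Longrightarrow> f (r \<odot>\<^bsub>M\<^esub> x) = r \<odot>\<^bsub>N\<^esub> f x"
  using assms that unfolding module_iso_def iso_def hom_def by auto

lemma module_iso_card_peirce:
  assumes "module_iso R M N" "e \<in> carrier R" "left_module R M"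
  shows "card (peirce M e) = card (peirce N e)"
proof -
  interpret left_module R M by fact
  obtain f where f: "bij_betw f (carrier M) (carrier N)"
    "\<And>r x. \<lbrakk>r \<in> carrier R; x \<in> carrier M\<rbrakk> \<Longrightarrow> f (r \<odot>\<^bsub>M\<^esub> x) = r \<odot>\<^bsub>N\<^esub> f x"
    using module_isoD[OF assms(1)] by metis
  have "bij_betw f (peirce M e) (peirce N e)"
    unfolding bij_betw_def
  proof
    show "inj_on f (peirce M e)"
      using f(1) by (auto simp: bij_betw_def peirce_def intro: inj_on_subset)
    show "f ` peirce M e = peirce N e"
    proof (intro equalityI subsetI)
      fix y assume "y \<in> f ` peirce M e"
      then obtain x where x: "x \<in> carrier M" "e \<odot>\<^bsub>M\<^esub> x = x" "y = f x" by (auto simp: peirce_def)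
      then show "y \<in> peirce N e"
        using f(2)[OF assms(2) x(1)] bij_betwE[OF f(1)] by (auto simp: peirce_def)
    next
      fix y assume y: "y \<in> peirce N e"
      then obtain x where x: "x \<in> carrier M" "y = f x"
        using f(1) by (auto simp: peirce_def bij_betw_def)
      have "f (e \<odot>\<^bsub>M\<^esub> x) = f x" using f(2)[OF assms(2) x(1)] x y by (simp add: peirce_def)
      then have "e \<odot>\<^bsub>M\<^esub> x = x"
        using f(1) x assms(2) by (auto simp: bij_betw_def inj_on_def)
      then show "y \<in> f ` peirce M e" using x by (auto simp: peirce_def)
    qed
  qed
  then show ?thesis by (rule bij_betw_same_card)
qed

text \<open>
  A counterexample \<open>r\<close> would yield \<open>z \<in> eRe\<close> with \<open>z x = 0\<close> and \<open>z y = y\<close>, so neither \<open>z\<close> nor \<open>e - z\<close> has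
  a left inverse.
\<close>

lemma simple_module_annihilator:
  assumes "left_module R S" "left_module R V" "simple_module R V"
    and "finite (carrier R)" "primitive_idempotent R e"
    and x: "x \<in> peirce S e" "x \<noteq> \<zero>\<^bsub>S\<^esub>" and y: "y \<in> peirce V e"
    and r: "r \<in> carrier R" "r \<odot>\<^bsub>S\<^esub> x = \<zero>\<^bsub>S\<^esub>"
  shows "r \<odot>\<^bsub>V\<^esub> y = \<zero>\<^bsub>V\<^esub>"
proof (rule ccontr)
  interpret S: left_module R S by fact
  interpret V: left_module R V by fact
  note e = S.R.primitive_idempotentD[OF assms(5)]
  have xS: "x \<in> carrier S" "e \<odot>\<^bsub>S\<^esub> x = x" and yV: "y \<in> carrier V" "e \<odot>\<^bsub>V\<^esub> y = y"
    using x y by (auto simp: peirce_def)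
  assume ry: "r \<odot>\<^bsub>V\<^esub> y \<noteq> \<zero>\<^bsub>V\<^esub>"
  then obtain s where s: "s \<in> carrier R" "y = s \<odot>\<^bsub>V\<^esub> (r \<odot>\<^bsub>V\<^esub> y)"
    using V.simple_module_generate[OF assms(3), of "r \<odot>\<^bsub>V\<^esub> y" y] r yV by auto
  define z where "z = e \<otimes>\<^bsub>R\<^esub> (s \<otimes>\<^bsub>R\<^esub> (r \<otimes>\<^bsub>R\<^esub> e))"
  have z: "z \<in> carrier R" "e \<otimes>\<^bsub>R\<^esub> z = z" "z \<otimes>\<^bsub>R\<^esub> e = z"
    using e s r by (simp_all add: z_def S.R.m_assoc) (simp add: e flip: S.R.m_assoc)
  have zx: "z \<odot>\<^bsub>S\<^esub> x = \<zero>\<^bsub>S\<^esub>" and zy: "z \<odot>\<^bsub>V\<^esub> y = y"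
    using e s r xS yV by (simp_all add: z_def S.smult_assoc V.smult_assoc flip: s(2))
  from S.R.primitive_idempotent_local[OF assms(4,5) z] show False
  proof (elim disjE bexE)
    fix u assume u: "u \<in> carrier R" "u \<otimes>\<^bsub>R\<^esub> z = e"
    have "x = u \<odot>\<^bsub>S\<^esub> (z \<odot>\<^bsub>S\<^esub> x)" using u z xS by (simp flip: S.smult_assoc)
    then show False using zx x(2) u(1) by simp
  next
    fix u assume u: "u \<in> carrier R" "u \<otimes>\<^bsub>R\<^esub> (e \<ominus>\<^bsub>R\<^esub> z) = e"
    have "y = u \<odot>\<^bsub>V\<^esub> ((e \<ominus>\<^bsub>R\<^esub> z) \<odot>\<^bsub>V\<^esub> y)" using u z e yV by (simp flip: V.smult_assoc)
    also have "(e \<ominus>\<^bsub>R\<^esub> z) \<odot>\<^bsub>V\<^esub> y = \<zero>\<^bsub>V\<^esub>"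
      using zy e z yV by (simp add: V.smult_diff_l V.M.minus_eq_zero_iff)
    finally have "y = \<zero>\<^bsub>V\<^esub>" using u(1) by simp
    then show False using ry r(1) by simp
  qed
qed

text \<open>By \<open>simple_module_annihilator\<close> in both directions, \<open>x\<close> and
  \<open>y\<close> have the same annihilator, so rx \<mapsto> ry is well defined and injective;
  simplicity of \<open>V\<close> makes it onto. Hence a primitive idempotent singles out one
  isomorphism class of simple modules, those it does not kill.\<close>

lemma simple_modules_iso:
  assumes "left_module R S" "simple_module R S" "left_module R V" "simple_module R V"
    and "finite (carrier R)" "primitive_idempotent R e"
    and x: "x \<in> peirce S e" "x \<noteq> \<zero>\<^bsub>S\<^esub>" and y: "y \<in> peirce V e" "y \<noteq> \<zero>\<^bsub>V\<^esub>"
  shows "module_iso R S V"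
proof -
  interpret S: left_module R S by fact
  interpret V: left_module R V by fact
  have xS: "x \<in> carrier S" and yV: "y \<in> carrier V"
    using x y by (auto simp: peirce_def)
  \<comment> \<open>Any r with w = rx may be chosen; \<open>eq_iff\<close> below shows that ry does
    not depend on the choice.\<close>
  define f where "f w = (SOME r. r \<in> carrier R \<and> w = r \<odot>\<^bsub>S\<^esub> x) \<odot>\<^bsub>V\<^esub> y" for w
  have iff: "r \<odot>\<^bsub>S\<^esub> x = \<zero>\<^bsub>S\<^esub> \<longleftrightarrow> r \<odot>\<^bsub>V\<^esub> y = \<zero>\<^bsub>V\<^esub>" if "r \<in> carrier R" for r
    using simple_module_annihilator[OF assms(1,3,4,5,6) x y(1) that]
      simple_module_annihilator[OF assms(3,1,2,5,6) y x(1) that] by blast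
  have eq_iff: "r \<odot>\<^bsub>S\<^esub> x = s \<odot>\<^bsub>S\<^esub> x \<longleftrightarrow> r \<odot>\<^bsub>V\<^esub> y = s \<odot>\<^bsub>V\<^esub> y"
    if "r \<in> carrier R" "s \<in> carrier R" for r s
    using iff[of "r \<ominus>\<^bsub>R\<^esub> s"] that xS yV by (simp add: S.smult_diff_l V.smult_diff_l S.M.minus_eq_zero_iff V.M.minus_eq_zero_iff)
  have f: "f (r \<odot>\<^bsub>S\<^esub> x) = r \<odot>\<^bsub>V\<^esub> y" if "r \<in> carrier R" for r
  proof -
    let ?s = "SOME s. s \<in> carrier R \<and> r \<odot>\<^bsub>S\<^esub> x = s \<odot>\<^bsub>S\<^esub> x"
    have "?s \<in> carrier R \<and> r \<odot>\<^bsub>S\<^esub> x = ?s \<odot>\<^bsub>S\<^esub> x" by (rule someI[of _ r]) (use that in simp)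
    then have "r \<odot>\<^bsub>V\<^esub> y = ?s \<odot>\<^bsub>V\<^esub> y" using eq_iff[of r ?s] that by blast
    then show ?thesis by (simp add: f_def)
  qed
  have gen: thesis if "w \<in> carrier S" "\<And>r. \<lbrakk>r \<in> carrier R; w = r \<odot>\<^bsub>S\<^esub> x\<rbrakk> \<Longrightarrow> thesis" for w thesis
    using S.simple_module_generate[OF assms(2) xS x(2) that(1)] that(2) .
  show ?thesis
  proof (rule module_isoI[of f])
    show "bij_betw f (carrier S) (carrier V)"
    proof (rule bij_betw_imageI)
      show "inj_on f (carrier S)"
      proof (rule inj_onI)
        fix w w' assume w: "w \<in> carrier S" "w' \<in> carrier S" "f w = f w'"
        obtain r where r: "r \<in> carrier R" "w = r \<odot>\<^bsub>S\<^esub> x" using gen[OF w(1)] .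
        obtain r' where r': "r' \<in> carrier R" "w' = r' \<odot>\<^bsub>S\<^esub> x" using gen[OF w(2)] .
        show "w = w'" using w(3) r r' f eq_iff by simp
      qed
      show "f ` carrier S = carrier V"
      proof (intro equalityI subsetI)
        fix v assume "v \<in> f ` carrier S"
        then obtain w where w: "w \<in> carrier S" "v = f w" by blast
        obtain r where "r \<in> carrier R" "w = r \<odot>\<^bsub>S\<^esub> x" using gen[OF w(1)] .
        then show "v \<in> carrier V" using w f yV by simp
      next
        fix v assume v: "v \<in> carrier V"
        obtain r where "r \<in> carrier R" "v = r \<odot>\<^bsub>V\<^esub> y"
          using V.simple_module_generate[OF assms(4) yV y(2) v] .
        then show "v \<in> f ` carrier S" using f xS by (intro image_eqI[of _ _ "r \<odot>\<^bsub>S\<^esub> x"]) auto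
      qed
    qed
  next
    fix w w' assume w: "w \<in> carrier S" "w' \<in> carrier S"
    obtain r where r: "r \<in> carrier R" "w = r \<odot>\<^bsub>S\<^esub> x" using gen[OF w(1)] .
    obtain r' where r': "r' \<in> carrier R" "w' = r' \<odot>\<^bsub>S\<^esub> x" using gen[OF w(2)] .
    have "f (w \<oplus>\<^bsub>S\<^esub> w') = f ((r \<oplus>\<^bsub>R\<^esub> r') \<odot>\<^bsub>S\<^esub> x)"
      using r r' xS by (simp add: S.smult_l_distr)
    then show "f (w \<oplus>\<^bsub>S\<^esub> w') = f w \<oplus>\<^bsub>V\<^esub> f w'"
      using r r' yV by (simp add: f V.smult_l_distr)
  next
    fix s w assume s: "s \<in> carrier R" and w: "w \<in> carrier S"
    obtain r where r: "r \<in> carrier R" "w = r \<odot>\<^bsub>S\<^esub> x" using gen[OF w] .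
    have "f (s \<odot>\<^bsub>S\<^esub> w) = f ((s \<otimes>\<^bsub>R\<^esub> r) \<odot>\<^bsub>S\<^esub> x)"
      using r s xS by (simp add: S.smult_assoc)
    then show "f (s \<odot>\<^bsub>S\<^esub> w) = s \<odot>\<^bsub>V\<^esub> f w"
      using r s yV by (simp add: f V.smult_assoc)
  qed
qed

context left_module
begin

text \<open>As \<open>x\<close> and \<open>y\<close> generate each other, there are b in fRe and c
  in eRf with bx = y and cy = x. Then cb fixes \<open>x\<close>, so e is no left multiple of e - cb,
  and locality of eRe yields u with u(cb) = e. With a = euc one gets ab = e, and ba is a nonzero
  idempotent of fRf, hence equal to \<open>f\<close>.\<close>

lemma simple_module_equiv_idem:
  assumes "simple_module R M" "finite (carrier R)"
    and "primitive_idempotent R e" "primitive_idempotent R f"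
    and x: "x \<in> peirce M e" "x \<noteq> \<zero>\<^bsub>M\<^esub>" and y: "y \<in> peirce M f" "y \<noteq> \<zero>\<^bsub>M\<^esub>"
  shows "equiv_idem R e f"
proof -
  note e = R.primitive_idempotentD[OF assms(3)] and f = R.primitive_idempotentD[OF assms(4)]
  have xM: "x \<in> carrier M" "e \<odot>\<^bsub>M\<^esub> x = x" and yM: "y \<in> carrier M" "f \<odot>\<^bsub>M\<^esub> y = y"
    using x y by (auto simp: peirce_def)
  obtain r where r: "r \<in> carrier R" "y = r \<odot>\<^bsub>M\<^esub> x"
    using simple_module_generate[OF assms(1) xM(1) x(2) yM(1)] .
  obtain s where s: "s \<in> carrier R" "x = s \<odot>\<^bsub>M\<^esub> y"
    using simple_module_generate[OF assms(1) yM(1) y(2) xM(1)] .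
  define b where "b = f \<otimes> (r \<otimes> e)"
  define c where "c = e \<otimes> (s \<otimes> f)"
  have b: "b \<in> carrier R" "f \<otimes> b = b" "b \<otimes> e = b"
    using e f r by (simp_all add: b_def R.m_assoc) (simp add: f flip: R.m_assoc)
  have c: "c \<in> carrier R" "e \<otimes> c = c" "c \<otimes> f = c"
    using e f s by (simp_all add: c_def R.m_assoc) (simp add: e flip: R.m_assoc)
  have bx: "b \<odot>\<^bsub>M\<^esub> x = y" using e f r xM yM by (simp add: b_def smult_assoc)
  have cy: "c \<odot>\<^bsub>M\<^esub> y = x" using e f s xM yM by (simp add: c_def smult_assoc)
  have z: "c \<otimes> b \<in> carrier R" "e \<otimes> (c \<otimes> b) = c \<otimes> b" "(c \<otimes> b) \<otimes> e = c \<otimes> b"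
    using b c e by (simp_all add: R.m_assoc) (simp add: c flip: R.m_assoc)
  have zx: "(c \<otimes> b) \<odot>\<^bsub>M\<^esub> x = x" using bx cy b c xM by (simp add: smult_assoc)
  have "\<not> (\<exists>u\<in>carrier R. u \<otimes> (e \<ominus> c \<otimes> b) = e)"
  proof
    assume "\<exists>u\<in>carrier R. u \<otimes> (e \<ominus> c \<otimes> b) = e"
    then obtain u where u: "u \<in> carrier R" "u \<otimes> (e \<ominus> c \<otimes> b) = e" by blast
    have "x = u \<odot>\<^bsub>M\<^esub> ((e \<ominus> c \<otimes> b) \<odot>\<^bsub>M\<^esub> x)" using u z e xM by (simp flip: smult_assoc)
    also have "(e \<ominus> c \<otimes> b) \<odot>\<^bsub>M\<^esub> x = \<zero>\<^bsub>M\<^esub>"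
      using zx e z xM by (simp add: smult_diff_l M.minus_eq_zero_iff)
    finally show False using u(1) x(2) by simp
  qed
  then obtain u where u: "u \<in> carrier R" "u \<otimes> (c \<otimes> b) = e"
    using R.primitive_idempotent_local[OF assms(2,3) z] by blast
  define a where "a = e \<otimes> (u \<otimes> c)"
  have a: "a \<in> carrier R" "e \<otimes> a = a" "a \<otimes> f = a"
    using e f c u by (simp_all add: a_def R.m_assoc) (simp add: e flip: R.m_assoc)
  have ab: "a \<otimes> b = e" using e u b c by (simp add: a_def R.m_assoc)
  have "(b \<otimes> a) \<otimes> (b \<otimes> a) = b \<otimes> ((a \<otimes> b) \<otimes> a)" using a b by (simp add: R.m_assoc)
  then have ba: "(b \<otimes> a) \<otimes> (b \<otimes> a) = b \<otimes> a" using ab a by simp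
  have "f \<otimes> (b \<otimes> a) = b \<otimes> a" "(b \<otimes> a) \<otimes> f = b \<otimes> a"
    using a b f by (simp flip: R.m_assoc, simp add: R.m_assoc)
  moreover have "b \<otimes> a \<noteq> \<zero>"
  proof
    assume "b \<otimes> a = \<zero>"
    have "e = (a \<otimes> b) \<otimes> (a \<otimes> b)" using ab e by simp
    also have "\<dots> = a \<otimes> ((b \<otimes> a) \<otimes> b)" using a b by (simp add: R.m_assoc)
    also have "\<dots> = \<zero>" using \<open>b \<otimes> a = \<zero>\<close> a b by simp
    finally show False using e by simp
  qed
  ultimately have "b \<otimes> a = f"
    using R.primitive_idempotent_trivial[OF assms(4), of "b \<otimes> a"] ba a b by auto
  then show ?thesis using a b ab unfolding equiv_idem_def by blast
qed

lemma zero_in_peirce: "e \<in> carrier R \<Longrightarrow> \<zero>\<^bsub>M\<^esub> \<in> peirce M e"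
  by (simp add: peirce_def)

text \<open>The map is multiplication by the element \<open>b\<close> of the equivalence;
  multiplication by \<open>a\<close> undoes it because ab = e.\<close>

lemma equiv_idem_peirce:
  assumes "equiv_idem R e f" "e \<in> carrier R" "f \<in> carrier R"
  obtains h where "inj_on h (peirce M e)" "h ` peirce M e \<subseteq> peirce M f" "h \<zero>\<^bsub>M\<^esub> = \<zero>\<^bsub>M\<^esub>"
proof -
  obtain a b where ab: "a \<in> carrier R" "b \<in> carrier R" "f \<otimes> b = b" "a \<otimes> b = e"
    using assms(1) unfolding equiv_idem_def by blast
  show thesis
  proof (rule that[of "\<lambda>x. b \<odot>\<^bsub>M\<^esub> x"])
    show "inj_on (\<lambda>x. b \<odot>\<^bsub>M\<^esub> x) (peirce M e)"
    proof (rule inj_on_inverseI[of _ "\<lambda>x. a \<odot>\<^bsub>M\<^esub> x"])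
      fix x assume "x \<in> peirce M e"
      then show "a \<odot>\<^bsub>M\<^esub> (b \<odot>\<^bsub>M\<^esub> x) = x"
        using ab by (simp add: peirce_def flip: smult_assoc)
    qed
    show "(\<lambda>x. b \<odot>\<^bsub>M\<^esub> x) ` peirce M e \<subseteq> peirce M f"
      using ab assms(3) by (auto simp: peirce_def simp flip: smult_assoc)
  qed (use ab in simp)
qed

lemma card_peirce_mono:
  assumes "equiv_idem R e f" "e \<in> carrier R" "f \<in> carrier R" "finite (carrier M)"
  shows "card (peirce M e) \<le> card (peirce M f)"
proof -
  obtain h where h: "inj_on h (peirce M e)" "h ` peirce M e \<subseteq> peirce M f"
    using equiv_idem_peirce[OF assms(1-3)] .
  moreover have "finite (peirce M f)" using assms(4) by (simp add: peirce_def)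
  ultimately show ?thesis by (rule card_inj_on_le)
qed

lemma peirce_nontrivial_mono:
  assumes "equiv_idem R e f" "e \<in> carrier R" "f \<in> carrier R" "peirce M e \<noteq> {\<zero>\<^bsub>M\<^esub>}"
  shows "peirce M f \<noteq> {\<zero>\<^bsub>M\<^esub>}"
proof -
  obtain h where h: "inj_on h (peirce M e)" "h ` peirce M e \<subseteq> peirce M f" "h \<zero>\<^bsub>M\<^esub> = \<zero>\<^bsub>M\<^esub>"
    using equiv_idem_peirce[OF assms(1-3)] .
  obtain x where x: "x \<in> peirce M e" "x \<noteq> \<zero>\<^bsub>M\<^esub>"
    using assms(4) zero_in_peirce[OF assms(2)] by blast
  then have "h x \<noteq> h \<zero>\<^bsub>M\<^esub>" using h(1) zero_in_peirce[OF assms(2)] by (auto simp: inj_on_def)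
  then show ?thesis using x h by auto
qed

end

subsection \<open>Quotient modules\<close>

context left_module
begin

lemma submodule_abelian_subgroup: "submodule N R M \<Longrightarrow> abelian_subgroup N M"
  by (intro abelian_subgroupI3 additive_subgroupI) (auto dest: submodule.axioms(1) intro: M.abelian_group_axioms)

lemma self_in_coset:
  assumes "submodule N R M" "x \<in> carrier M"
  shows "x \<in> N +>\<^bsub>M\<^esub> x"
  using abelian_subgroup.a_rcos_self[OF submodule_abelian_subgroup[OF assms(1)] assms(2)] .

lemma coset_eq_iff:
  assumes "submodule N R M" "x \<in> carrier M" "y \<in> carrier M"
  shows "N +>\<^bsub>M\<^esub> x = N +>\<^bsub>M\<^esub> y \<longleftrightarrow> x \<ominus>\<^bsub>M\<^esub> y \<in> N"
proof -
  note N = submoduleD[OF assms(1)]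
  have sub: "subgroup N (add_monoid M)" using assms(1) by (rule submodule.axioms)
  note self = self_in_coset[OF assms(1,2)]
  show ?thesis
  proof
    assume "N +>\<^bsub>M\<^esub> x = N +>\<^bsub>M\<^esub> y"
    then obtain h where h: "h \<in> N" "x = h \<oplus>\<^bsub>M\<^esub> y" using self by (auto simp: a_r_coset_def')
    then have "x \<ominus>\<^bsub>M\<^esub> y = h"
      using assms(3) N(1) by (auto simp: M.minus_eq M.a_assoc M.r_neg)
    then show "x \<ominus>\<^bsub>M\<^esub> y \<in> N" using h by simp
  next
    assume *: "x \<ominus>\<^bsub>M\<^esub> y \<in> N"
    have "x = (x \<ominus>\<^bsub>M\<^esub> y) \<oplus>\<^bsub>M\<^esub> y"
      using assms by (simp add: M.minus_eq M.a_assoc M.l_neg)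
    then have "x \<in> N +>\<^bsub>M\<^esub> y" using * by (auto simp: a_r_coset_def')
    then show "N +>\<^bsub>M\<^esub> x = N +>\<^bsub>M\<^esub> y"
      using M.a_repr_independence[OF _ assms(3) sub] by simp
  qed
qed

lemma coset_zero:
  assumes "submodule N R M"
  shows "N +>\<^bsub>M\<^esub> \<zero>\<^bsub>M\<^esub> = N"
  using submoduleD(1)[OF assms] by (rule M.a_coset_add_zero)

lemma coset_eq_zero_iff:
  assumes "submodule N R M" "x \<in> carrier M"
  shows "N +>\<^bsub>M\<^esub> x = N \<longleftrightarrow> x \<in> N"
proof -
  have "x \<ominus>\<^bsub>M\<^esub> \<zero>\<^bsub>M\<^esub> = x"
    using assms(2) M.minus_equality[of "\<zero>\<^bsub>M\<^esub>" "\<zero>\<^bsub>M\<^esub>"] by (simp add: M.minus_eq)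
  then show ?thesis
    using coset_eq_iff[OF assms M.zero_closed] coset_zero[OF assms(1)] by simp
qed

lemma coset_add:
  assumes "submodule N R M" "x \<in> carrier M" "y \<in> carrier M"
  shows "(N +>\<^bsub>M\<^esub> x) <+>\<^bsub>M\<^esub> (N +>\<^bsub>M\<^esub> y) = N +>\<^bsub>M\<^esub> (x \<oplus>\<^bsub>M\<^esub> y)"
  using abelian_subgroup.a_rcos_sum[OF submodule_abelian_subgroup[OF assms(1)] assms(2,3)] .

lemma quot_module_simps:
  "carrier (quot_module M N) = (\<lambda>x. N +>\<^bsub>M\<^esub> x) ` carrier M"
  "\<zero>\<^bsub>quot_module M N\<^esub> = N"
  by (auto simp: quot_module_def A_RCOSETS_def')

lemma quot_module_add:
  assumes "submodule N R M" "x \<in> carrier M" "y \<in> carrier M"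
  shows "(N +>\<^bsub>M\<^esub> x) \<oplus>\<^bsub>quot_module M N\<^esub> (N +>\<^bsub>M\<^esub> y) = N +>\<^bsub>M\<^esub> (x \<oplus>\<^bsub>M\<^esub> y)"
  using coset_add[OF assms] by (simp add: quot_module_def)

text \<open>Scalar multiplication on cosets is defined as a union over all representatives. The
  union collapses because representatives of one coset differ by some h in \<open>N\<close>, and rh
  stays in \<open>N\<close>.\<close>

lemma quot_module_smult:
  assumes "submodule N R M" "r \<in> carrier R" "x \<in> carrier M"
  shows "r \<odot>\<^bsub>quot_module M N\<^esub> (N +>\<^bsub>M\<^esub> x) = N +>\<^bsub>M\<^esub> (r \<odot>\<^bsub>M\<^esub> x)"
proof -
  note N = submoduleD[OF assms(1)]
  have "N +>\<^bsub>M\<^esub> (r \<odot>\<^bsub>M\<^esub> z) = N +>\<^bsub>M\<^esub> (r \<odot>\<^bsub>M\<^esub> x)" if "z \<in> N +>\<^bsub>M\<^esub> x" for z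
  proof -
    obtain h where h: "h \<in> N" "z = h \<oplus>\<^bsub>M\<^esub> x" using \<open>z \<in> N +>\<^bsub>M\<^esub> x\<close> by (auto simp: a_r_coset_def')
    have hM: "h \<in> carrier M" using h(1) N(1) by auto
    have "r \<odot>\<^bsub>M\<^esub> z \<ominus>\<^bsub>M\<^esub> r \<odot>\<^bsub>M\<^esub> x = r \<odot>\<^bsub>M\<^esub> h"
      using h hM assms(2,3) by (simp add: smult_r_distr M.minus_eq M.a_assoc M.r_neg)
    then show ?thesis
      using coset_eq_iff[OF assms(1), of "r \<odot>\<^bsub>M\<^esub> z" "r \<odot>\<^bsub>M\<^esub> x"] h hM assms(2,3) N(4) by simp
  qed
  moreover have "x \<in> N +>\<^bsub>M\<^esub> x"
    using self_in_coset[OF assms(1,3)] .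
  ultimately have "(\<Union>z\<in>N +>\<^bsub>M\<^esub> x. N +>\<^bsub>M\<^esub> (r \<odot>\<^bsub>M\<^esub> z)) = N +>\<^bsub>M\<^esub> (r \<odot>\<^bsub>M\<^esub> x)" by blast
  then show ?thesis by (simp add: quot_module_def)
qed

lemma quot_module_is_left_module:
  assumes "submodule N R M"
  shows "left_module R (quot_module M N)"
proof -
  note N = submoduleD[OF assms]
  note simps = quot_module_add[OF assms] quot_module_smult[OF assms] quot_module_simps
  have zero: "\<zero>\<^bsub>quot_module M N\<^esub> = N +>\<^bsub>M\<^esub> \<zero>\<^bsub>M\<^esub>"
    by (simp add: quot_module_simps coset_zero[OF assms])
  have "abelian_group (quot_module M N)"
  proof (rule abelian_groupI)
    fix X assume "X \<in> carrier (quot_module M N)"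
    then obtain x where x: "x \<in> carrier M" "X = N +>\<^bsub>M\<^esub> x" by (auto simp: simps)
    show "\<exists>Y\<in>carrier (quot_module M N). Y \<oplus>\<^bsub>quot_module M N\<^esub> X = \<zero>\<^bsub>quot_module M N\<^esub>"
      by (rule bexI[of _ "N +>\<^bsub>M\<^esub> (\<ominus>\<^bsub>M\<^esub> x)"])
        (use x in \<open>simp_all add: simps(1,2) zero M.l_neg quot_module_simps(1)\<close>)
  next
    show "\<zero>\<^bsub>quot_module M N\<^esub> \<in> carrier (quot_module M N)"
      unfolding zero by (simp add: quot_module_simps(1))
  qed (auto simp: simps(1,2) zero quot_module_simps(1) M.a_ac)
  then show ?thesis
    by (intro left_module.intro left_module_axioms.intro)
      (auto simp: R.ring_axioms simps(1,2) quot_module_simps(1) smult_l_distr smult_r_distr smult_assoc)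
qed

lemma quot_module_finsum:
  assumes "submodule N R M" "finite A" "f \<in> A \<rightarrow> carrier M"
  shows "(\<Oplus>\<^bsub>quot_module M N\<^esub>i\<in>A. N +>\<^bsub>M\<^esub> f i) = N +>\<^bsub>M\<^esub> (\<Oplus>\<^bsub>M\<^esub>i\<in>A. f i)"
proof -
  interpret Q: left_module R "quot_module M N" by (rule quot_module_is_left_module) fact
  show ?thesis using assms(2,3)
  proof (induct set: finite)
    case empty
    then show ?case by (simp add: quot_module_simps coset_zero[OF assms(1)])
  next
    case (insert a A)
    then have "(\<lambda>i. N +>\<^bsub>M\<^esub> f i) \<in> insert a A \<rightarrow> carrier (quot_module M N)"
      by (auto simp: quot_module_simps)
    then show ?case
      using insert by (simp add: Pi_def quot_module_add[OF assms(1)])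
  qed
qed

lemma quot_module_simple:
  assumes "maximal_submodule N R M"
  shows "simple_module R (quot_module M N)"
proof -
  have sub: "submodule N R M" and ne: "N \<noteq> carrier M"
    using assms by (auto simp: maximal_submodule_def)
  note N = submoduleD[OF sub]
  interpret Q: left_module R "quot_module M N" by (rule quot_module_is_left_module) fact
  obtain x where x: "x \<in> carrier M" "x \<notin> N" using ne N(1) by blast
  have "carrier (quot_module M N) \<noteq> {\<zero>\<^bsub>quot_module M N\<^esub>}"
    using x coset_eq_zero_iff[OF sub x(1)] by (auto simp: quot_module_simps)
  moreover have "\<exists>r\<in>carrier R. Y = r \<odot>\<^bsub>quot_module M N\<^esub> X"
    if X: "X \<in> carrier (quot_module M N) - {\<zero>\<^bsub>quot_module M N\<^esub>}" and Y: "Y \<in> carrier (quot_module M N)" for X Y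
  proof -
    obtain x y where xy: "x \<in> carrier M" "X = N +>\<^bsub>M\<^esub> x" "y \<in> carrier M" "Y = N +>\<^bsub>M\<^esub> y"
      using X Y by (auto simp: quot_module_simps)
    have "x \<notin> N" using X xy coset_eq_zero_iff[OF sub xy(1)] by (simp add: quot_module_simps)
    then obtain r k where r: "r \<in> carrier R" "k \<in> N" "y = r \<odot>\<^bsub>M\<^esub> x \<oplus>\<^bsub>M\<^esub> k"
      using maximal_submodule_generate[OF assms xy(1) _ xy(3)] by metis
    have k: "k \<in> carrier M" using r(2) N(1) by auto
    have "y \<ominus>\<^bsub>M\<^esub> r \<odot>\<^bsub>M\<^esub> x = k"
      using r xy(1) k by (simp add: M.minus_eq M.a_ac M.r_neg)
    then have "Y = N +>\<^bsub>M\<^esub> (r \<odot>\<^bsub>M\<^esub> x)"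
      using coset_eq_iff[OF sub xy(3), of "r \<odot>\<^bsub>M\<^esub> x"] xy r by simp
    then show ?thesis using quot_module_smult[OF sub r(1) xy(1)] xy r(1) by auto
  qed
  ultimately show ?thesis using Q.simple_module_iff by blast
qed

lemma module_radical_submodule: "submodule (module_radical R M) R M"
  by (rule submoduleI) (auto simp: module_radical_def maximal_submodule_def dest: submoduleD)

lemma card_submodule_quotient:
  assumes "submodule N R M" "finite (carrier M)"
  shows "card (carrier M) = card N * card (carrier (quot_module M N))"
  using M.add.lagrange_finite[of N] assms submodule.axioms(1)[OF assms(1)]
  by (simp add: quot_module_def A_RCOSETS_def order_def mult.commute)

end

lemma regular_module_simps [simp]:
  "carrier (regular_module R) = carrier R"
  "\<zero>\<^bsub>regular_module R\<^esub> = \<zero>\<^bsub>R\<^esub>"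
  "x \<oplus>\<^bsub>regular_module R\<^esub> y = x \<oplus>\<^bsub>R\<^esub> y"
  "r \<odot>\<^bsub>regular_module R\<^esub> y = r \<otimes>\<^bsub>R\<^esub> y"
  by (simp_all add: regular_module_def)

lemma finsum_regular_module [simp]: "finsum (regular_module R) = finsum R"
  by (simp add: regular_module_def finsum_def finprod_def fun_eq_iff)

context ring
begin

lemma regular_left_module: "left_module R (regular_module R)"
proof -
  have "abelian_group (regular_module R)"
  proof (rule abelian_groupI)
    fix x assume "x \<in> carrier (regular_module R)"
    then show "\<exists>y\<in>carrier (regular_module R). y \<oplus>\<^bsub>regular_module R\<^esub> x = \<zero>\<^bsub>regular_module R\<^esub>"
      by (intro bexI[of _ "\<ominus> x"]) (simp_all add: l_neg)
  qed (simp_all add: a_ac)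
  then show ?thesis
    by (intro left_module.intro left_module_axioms.intro)
      (auto simp: ring_axioms l_distr r_distr m_assoc)
qed

end

subsection \<open>The Jacobson radical and the tops of principal modules\<close>

text \<open>The intersection of the maximal left ideals. Over \<open>opp_ring R\<close> the same
  expression intersects the maximal right ideals of \<open>R\<close>.\<close>

abbreviation jac_rad :: "('a, 'r) ring_scheme \<Rightarrow> 'a set"
  where "jac_rad R \<equiv> module_radical R (regular_module R)"

abbreviation principal_ideal :: "('a, 'r) ring_scheme \<Rightarrow> 'a \<Rightarrow> 'a set"
  where "principal_ideal R e \<equiv> {r \<otimes>\<^bsub>R\<^esub> e | r. r \<in> carrier R}"

lemma principal_module_eq:
  "principal_module R e = (regular_module R)\<lparr>carrier := principal_ideal R e\<rparr>"
  by (simp add: principal_module_def)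

context ring
begin

lemma principal_submodule: "e \<in> carrier R \<Longrightarrow> submodule (principal_ideal R e) R (regular_module R)"
  using left_module.cyclic_submodule[OF regular_left_module, of e] by simp

lemma principal_left_module: "e \<in> carrier R \<Longrightarrow> left_module R (principal_module R e)"
  unfolding principal_module_eq
  by (rule left_module.submodule_is_left_module[OF regular_left_module principal_submodule])

lemma principal_ideal_iff:
  assumes "e \<in> carrier R" "e \<otimes> e = e"
  shows "x \<in> principal_ideal R e \<longleftrightarrow> x \<in> carrier R \<and> x \<otimes> e = x"
  using assms by (auto simp: m_assoc) metis

lemma jac_rad_submodule: "submodule (jac_rad R) R (regular_module R)"
  by (rule left_module.module_radical_submodule[OF regular_left_module])

lemma regular_submoduleD:
  assumes "submodule H R (regular_module R)"
  shows "H \<subseteq> carrier R" "\<zero> \<in> H"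
    and "\<And>a b. \<lbrakk>a \<in> H; b \<in> H\<rbrakk> \<Longrightarrow> a \<oplus> b \<in> H"
    and "\<And>a x. \<lbrakk>a \<in> carrier R; x \<in> H\<rbrakk> \<Longrightarrow> a \<otimes> x \<in> H"
  using left_module.submoduleD(1-4)[OF regular_left_module assms] by simp_all

lemma regular_submodule_one:
  assumes "submodule H R (regular_module R)" "\<one> \<in> H"
  shows "H = carrier R"
proof -
  note H = regular_submoduleD[OF assms(1)]
  have "r \<in> H" if "r \<in> carrier R" for r using H(4)[OF that assms(2)] that by simp
  then show ?thesis using H(1) by blast
qed

lemma maximal_left_ideal_generate:
  assumes "maximal_submodule N R (regular_module R)" "x \<in> carrier R" "x \<notin> N" "y \<in> carrier R"
  obtains r k where "r \<in> carrier R" "k \<in> N" "y = r \<otimes> x \<oplus> k"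
  by (rule left_module.maximal_submodule_generate[OF regular_left_module assms(1), of x y])
    (use assms(2-) that in simp_all)

text \<open>Together with \<open>jac_rad_submodule\<close> this makes the radical two-sided. If xs
  avoided a maximal left ideal N, then N' = {y. ys in N} would be a maximal left ideal too, since y
  \<mapsto> ys embeds R/N' into the simple module R/N. So x would lie in N', which says that xs lies
  in N.\<close>

lemma jac_rad_right:
  assumes x: "x \<in> jac_rad R" and s: "s \<in> carrier R"
  shows "x \<otimes> s \<in> jac_rad R"
proof -
  have xR: "x \<in> carrier R" using x by (simp add: module_radical_def)
  have "x \<otimes> s \<in> N" if max: "maximal_submodule N R (regular_module R)" for N
  proof (rule ccontr)
    assume xs: "x \<otimes> s \<notin> N"
    have "submodule N R (regular_module R)" using max by (simp add: maximal_submodule_def)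
    note N = regular_submoduleD[OF this]
    define N' where "N' = {y \<in> carrier R. y \<otimes> s \<in> N}"
    have sub: "submodule N' R (regular_module R)"
      by (rule left_module.submoduleI[OF regular_left_module])
        (use s N in \<open>auto simp: N'_def l_distr m_assoc\<close>)
    have "maximal_submodule N' R (regular_module R)"
      unfolding maximal_submodule_def
    proof (intro conjI allI impI)
      show "N' \<noteq> carrier (regular_module R)" using xR xs by (auto simp: N'_def)
      fix B assume "submodule B R (regular_module R) \<and> N' \<subseteq> B"
      then have B: "submodule B R (regular_module R)" "N' \<subseteq> B" by auto
      note B' = regular_submoduleD[OF B(1)]
      show "B = N' \<or> B = carrier (regular_module R)"
      proof (rule disjCI)
        assume "B \<noteq> carrier (regular_module R)"
        show "B = N'"
        proof (rule ccontr)
          assume "B \<noteq> N'"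
          then obtain b where b: "b \<in> B" "b \<notin> N'" using B(2) by blast
          have bR: "b \<in> carrier R" using b(1) B'(1) by auto
          then have "b \<otimes> s \<notin> N" using b(2) by (simp add: N'_def)
          then obtain r k where r: "r \<in> carrier R" "k \<in> N" "s = r \<otimes> (b \<otimes> s) \<oplus> k"
            using maximal_left_ideal_generate[OF max _ _ s, of "b \<otimes> s"] bR s by auto
          have kR: "k \<in> carrier R" using r(2) N(1) by auto
          \<comment> \<open>Since s is congruent to rbs modulo \<open>N\<close>, the element 1 - rb
            lies in \<open>N'\<close> and so in \<open>B\<close>. Adding rb, which is in
            \<open>B\<close> as well, gives 1.\<close>
          have "(\<one> \<ominus> r \<otimes> b) \<otimes> s = s \<ominus> r \<otimes> (b \<otimes> s)"
            using r(1) bR s by (simp add: minus_eq l_distr l_minus m_assoc)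
          also have "\<dots> = (r \<otimes> (b \<otimes> s) \<oplus> k) \<ominus> r \<otimes> (b \<otimes> s)" using r(3) by simp
          also have "\<dots> = k"
            using r(1) bR s kR by (simp add: minus_eq a_ac r_neg)
          finally have "(\<one> \<ominus> r \<otimes> b) \<in> N'" using r bR by (simp add: N'_def)
          then have "(\<one> \<ominus> r \<otimes> b) \<oplus> r \<otimes> b \<in> B"
            using B'(3) B'(4)[OF r(1) b(1)] B(2) by blast
          then have "\<one> \<in> B" using r(1) bR by (simp add: minus_eq a_assoc l_neg)
          then show False
            using regular_submodule_one[OF B(1)] \<open>B \<noteq> carrier (regular_module R)\<close> by simp
        qed
      qed
    qed (rule sub)
    then have "x \<in> N'" using x by (auto simp: module_radical_def)
    then show False using xs by (simp add: N'_def)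
  qed
  then show ?thesis using xR s by (simp add: module_radical_def)
qed

text \<open>An element of Re outside the radical already generates Re. Some maximal left ideal N
  misses \<open>b\<close>, so e = rb + k with k in N, and z = erb in eRe satisfies e - z = ek, an
  element of N. If e were a left multiple of e - z, then e and hence b = be would lie in N. So
  locality leaves e = uz, a left multiple of \<open>b\<close>.\<close>

lemma primitive_in_submodule:
  assumes "finite (carrier R)" "primitive_idempotent R e"
    and "submodule B R (regular_module R)" "b \<in> B" "b \<otimes> e = b" "b \<notin> jac_rad R"
  shows "e \<in> B"
proof -
  note e = primitive_idempotentD[OF assms(2)] and B = regular_submoduleD[OF assms(3)]
  have b: "b \<in> carrier R" using assms(4) B(1) by auto
  obtain N where max: "maximal_submodule N R (regular_module R)" and bN: "b \<notin> N"
    using assms(6) b by (auto simp: module_radical_def)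
  have "submodule N R (regular_module R)" using max by (simp add: maximal_submodule_def)
  note N = regular_submoduleD[OF this]
  obtain r k where r: "r \<in> carrier R" "k \<in> N" "e = r \<otimes> b \<oplus> k"
    using maximal_left_ideal_generate[OF max b bN e(1)] .
  have kR: "k \<in> carrier R" using r(2) N(1) by auto
  define z where "z = e \<otimes> (r \<otimes> b)"
  have z: "z \<in> carrier R" "e \<otimes> z = z" "z \<otimes> e = z"
    using e r(1) b assms(5) by (simp_all add: z_def m_assoc) (simp add: e flip: m_assoc)
  have "e \<ominus> z = e \<otimes> e \<ominus> e \<otimes> (r \<otimes> b)" using e by (simp add: z_def)
  also have "e \<otimes> e = e \<otimes> (r \<otimes> b \<oplus> k)" using r(3) by simp
  also have "\<dots> \<ominus> e \<otimes> (r \<otimes> b) = e \<otimes> k"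
    using e(1) r(1) b kR by (simp add: r_distr minus_eq a_ac r_neg)
  finally have ez: "e \<ominus> z \<in> N" using N(4)[OF e(1) r(2)] by simp
  from primitive_idempotent_local[OF assms(1,2) z] show ?thesis
  proof (elim disjE bexE)
    fix u assume u: "u \<in> carrier R" "u \<otimes> z = e"
    then have "e = (u \<otimes> (e \<otimes> r)) \<otimes> b" using e(1) r(1) b by (simp add: z_def m_assoc)
    then show "e \<in> B" using B(4)[OF _ assms(4), of "u \<otimes> (e \<otimes> r)"] u(1) e(1) r(1) by simp
  next
    fix u assume u: "u \<in> carrier R" "u \<otimes> (e \<ominus> z) = e"
    then have "e \<in> N" using N(4)[OF u(1) ez] by simp
    then have "b \<in> N" using N(4)[OF b, of e] assms(5) by simp
    then show "e \<in> B" using bN by simp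
  qed
qed

text \<open>R(1 - e) is a proper left ideal because right multiplication by \<open>e\<close> kills
  it. A maximal left ideal above it cannot contain \<open>e\<close> as well, since it would then
  contain 1.\<close>

lemma primitive_not_in_jac_rad:
  assumes "finite (carrier R)" "primitive_idempotent R e"
  shows "e \<notin> jac_rad R"
proof
  note e = primitive_idempotentD[OF assms(2)]
  let ?I = "principal_ideal R (\<one> \<ominus> e)"
  assume J: "e \<in> jac_rad R"
  have f: "\<one> \<ominus> e \<in> carrier R" "(\<one> \<ominus> e) \<otimes> e = \<zero>"
    using e by (simp_all add: minus_eq l_distr l_minus r_neg)
  have "e \<notin> ?I"
  proof
    assume "e \<in> ?I"
    then obtain r where r: "r \<in> carrier R" "e = r \<otimes> (\<one> \<ominus> e)" by blast
    have "e = e \<otimes> e" using e by simp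
    also have "\<dots> = r \<otimes> ((\<one> \<ominus> e) \<otimes> e)" using r f(1) e(1) by (metis m_assoc)
    also have "\<dots> = \<zero>" using f(2) r(1) by simp
    finally show False using e(3) by simp
  qed
  then have "?I \<noteq> carrier (regular_module R)" using e(1) by auto
  then obtain N where max: "maximal_submodule N R (regular_module R)" and sub: "?I \<subseteq> N"
    using left_module.exists_maximal_submodule[OF regular_left_module _ principal_submodule[OF f(1)]]
      assms(1) by auto
  have N: "submodule N R (regular_module R)" "N \<noteq> carrier R"
    using max by (auto simp: maximal_submodule_def)
  have "\<one> \<otimes> (\<one> \<ominus> e) \<in> ?I" by blast
  then have "\<one> \<ominus> e \<in> N" using sub f(1) by auto
  moreover have "e \<in> N" using J max by (auto simp: module_radical_def)
  ultimately have "(\<one> \<ominus> e) \<oplus> e \<in> N" by (rule regular_submoduleD(3)[OF N(1)])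
  then have "\<one> \<in> N" using e(1) by (simp add: minus_eq a_assoc l_neg)
  then show False using regular_submodule_one[OF N(1)] N(2) by simp
qed

text \<open>Every proper submodule of Re lies in J \<inter> Re, because an element outside J would
  bring in \<open>e\<close> by \<open>primitive_in_submodule\<close>. So J \<inter> Re is the only
  maximal submodule and therefore the radical.\<close>

lemma principal_radical_maximal:
  assumes "finite (carrier R)" "primitive_idempotent R e"
  shows "maximal_submodule (module_radical R (principal_module R e)) R (principal_module R e)"
proof -
  note e = primitive_idempotentD[OF assms(2)]
  let ?P = "principal_module R e" and ?I = "principal_ideal R e"
  have carrier: "carrier ?P = ?I" by (simp add: principal_module_def)
  have sub_iff: "submodule B R ?P \<longleftrightarrow> submodule B R (regular_module R) \<and> B \<subseteq> ?I" for B
    unfolding principal_module_eq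
    by (rule left_module.submodule_of_submodule_iff[OF regular_left_module principal_submodule[OF e(1)]])
  have below: "B \<subseteq> jac_rad R \<inter> ?I" if "submodule B R ?P" "B \<noteq> ?I" for B
  proof (rule ccontr)
    have B: "submodule B R (regular_module R)" "B \<subseteq> ?I" using that(1) sub_iff by auto
    assume "\<not> B \<subseteq> jac_rad R \<inter> ?I"
    then obtain b where b: "b \<in> B" "b \<notin> jac_rad R" using B(2) by blast
    have "b \<otimes> e = b" using b(1) B(2) principal_ideal_iff[OF e(1,2)] by blast
    then have "e \<in> B" using primitive_in_submodule[OF assms B(1) b(1) _ b(2)] by simp
    then have "?I \<subseteq> B" using regular_submoduleD(4)[OF B(1)] by blast
    then show False using B(2) that(2) by blast
  qed
  have "e \<in> ?I" using principal_ideal_iff[OF e(1,2)] e by simp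
  then have proper: "jac_rad R \<inter> ?I \<noteq> ?I" using primitive_not_in_jac_rad[OF assms] by blast
  have "submodule (jac_rad R \<inter> ?I) R (regular_module R)"
    by (rule left_module.submoduleI[OF regular_left_module])
      (use regular_submoduleD[OF jac_rad_submodule] regular_submoduleD[OF principal_submodule[OF e(1)]]
        in auto)
  then have sub: "submodule (jac_rad R \<inter> ?I) R ?P" using sub_iff by blast
  have max_iff: "maximal_submodule N R ?P \<longleftrightarrow> N = jac_rad R \<inter> ?I" for N
  proof
    assume N: "maximal_submodule N R ?P"
    then have "submodule N R ?P" "N \<noteq> ?I" by (auto simp: maximal_submodule_def carrier)
    then have "N \<subseteq> jac_rad R \<inter> ?I" by (rule below)
    then show "N = jac_rad R \<inter> ?I"
      using N sub proper unfolding maximal_submodule_def carrier by fast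
  next
    assume "N = jac_rad R \<inter> ?I"
    then show "maximal_submodule N R ?P"
      using sub proper below unfolding maximal_submodule_def carrier by blast
  qed
  have "module_radical R ?P = jac_rad R \<inter> ?I"
    unfolding module_radical_def[of R ?P] carrier max_iff by auto
  then show ?thesis using max_iff by simp
qed

text \<open>The nonzero Peirce element is the class of \<open>e\<close> itself: if \<open>e\<close>
  were in the radical of Re, so would be all of Re.\<close>

lemma top_principal:
  assumes "finite (carrier R)" "primitive_idempotent R e"
  shows "left_module R (top_module R (principal_module R e))"
    and "simple_module R (top_module R (principal_module R e))"
    and "peirce (top_module R (principal_module R e)) e \<noteq> {\<zero>\<^bsub>top_module R (principal_module R e)\<^esub>}"
    and "finite (carrier (top_module R (principal_module R e)))"
proof -
  note e = primitive_idempotentD[OF assms(2)]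
  let ?P = "principal_module R e" and ?I = "principal_ideal R e"
  let ?N = "module_radical R ?P"
  have carrier: "carrier ?P = ?I" by (simp add: principal_module_def)
  interpret P: left_module R ?P by (rule principal_left_module) fact
  note max = principal_radical_maximal[OF assms]
  have sub: "submodule ?N R ?P" and ne: "?N \<noteq> ?I" using max by (auto simp: maximal_submodule_def carrier)
  show "left_module R (top_module R ?P)"
    unfolding top_module_def by (rule P.quot_module_is_left_module[OF sub])
  show "simple_module R (top_module R ?P)"
    unfolding top_module_def by (rule P.quot_module_simple[OF max])
  show "finite (carrier (top_module R ?P))"
    using assms(1) by (simp add: top_module_def P.quot_module_simps carrier)
  have eP: "e \<in> carrier ?P" using principal_ideal_iff[OF e(1,2)] e by (simp add: carrier)
  have "e \<notin> ?N"
  proof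
    assume eN: "e \<in> ?N"
    have "r \<otimes> e \<in> ?N" if "r \<in> carrier R" for r
      using P.submoduleD(4)[OF sub that eN] by (simp add: principal_module_def)
    then have "?I \<subseteq> ?N" by blast
    then show False using ne P.submoduleD(1)[OF sub] carrier by blast
  qed
  then have "?N +>\<^bsub>?P\<^esub> e \<noteq> ?N" using P.coset_eq_zero_iff[OF sub eP] by simp
  moreover have "?N +>\<^bsub>?P\<^esub> e \<in> peirce (top_module R ?P) e"
    using P.quot_module_smult[OF sub e(1) eP] eP e(2)
    by (simp add: peirce_def top_module_def P.quot_module_simps) (simp add: principal_module_def)
  ultimately show "peirce (top_module R ?P) e \<noteq> {\<zero>\<^bsub>top_module R ?P\<^esub>}"
    by (auto simp: top_module_def P.quot_module_simps)
qed

end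

subsection \<open>Multiplicities in the top\<close>

context left_module
begin

lemma simple_decompositionD:
  assumes "simple_decomposition R M l S" "j < l"
  shows "submodule (S j) R M" "simple_module R (M\<lparr>carrier := S j\<rparr>)"
  using assms by (auto simp: simple_decomposition_def simple_submodule_def)

text \<open>Each summand is stable under \<open>f\<close> and the sum is direct, so an element is
  fixed by \<open>f\<close> exactly when all its components are.\<close>

lemma card_peirce_decomposition:
  assumes "simple_decomposition R M l S" "f \<in> carrier R"
  shows "card (peirce M f) = (\<Prod>j<l. card (peirce (M\<lparr>carrier := S j\<rparr>) f))"
proof -
  let ?sum = "\<lambda>s. \<Oplus>\<^bsub>M\<^esub>j\<in>{..<l}. s j"
  let ?P = "\<lambda>j. peirce (M\<lparr>carrier := S j\<rparr>) f"
  have S: "S j \<subseteq> carrier M" "\<And>x. x \<in> S j \<Longrightarrow> f \<odot>\<^bsub>M\<^esub> x \<in> S j" if "j < l" for j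
    using submoduleD(1,4)[OF simple_decompositionD(1)[OF assms(1) that]] assms(2) by blast+
  have bij: "bij_betw ?sum (\<Pi>\<^sub>E j\<in>{..<l}. S j) (carrier M)"
    using assms(1) by (simp add: simple_decomposition_def)
  have PS: "(\<Pi>\<^sub>E j\<in>{..<l}. ?P j) \<subseteq> (\<Pi>\<^sub>E j\<in>{..<l}. S j)"
    by (rule PiE_mono) (auto simp: peirce_def)
  have f_sum: "f \<odot>\<^bsub>M\<^esub> ?sum s = (\<Oplus>\<^bsub>M\<^esub>j\<in>{..<l}. f \<odot>\<^bsub>M\<^esub> s j)" if "s \<in> (\<Pi>\<^sub>E j\<in>{..<l}. S j)" for s
    by (rule smult_finsum) (use assms(2) that S(1) in \<open>auto simp: PiE_iff\<close>)
  have "bij_betw ?sum (\<Pi>\<^sub>E j\<in>{..<l}. ?P j) (peirce M f)"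
  proof (rule bij_betw_imageI)
    show "inj_on ?sum (\<Pi>\<^sub>E j\<in>{..<l}. ?P j)"
      using bij PS by (auto simp: bij_betw_def intro: inj_on_subset)
    show "?sum ` (\<Pi>\<^sub>E j\<in>{..<l}. ?P j) = peirce M f"
    proof (intro equalityI subsetI)
      fix y assume "y \<in> ?sum ` (\<Pi>\<^sub>E j\<in>{..<l}. ?P j)"
      then obtain s where s: "s \<in> (\<Pi>\<^sub>E j\<in>{..<l}. ?P j)" "y = ?sum s" by blast
      have s': "s \<in> (\<Pi>\<^sub>E j\<in>{..<l}. S j)" using s(1) PS by blast
      have "(\<Oplus>\<^bsub>M\<^esub>j\<in>{..<l}. f \<odot>\<^bsub>M\<^esub> s j) = ?sum s"
        by (rule M.finsum_cong') (use s s' S(1) in \<open>auto simp: PiE_iff peirce_def\<close>)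
      moreover have "?sum s \<in> carrier M" using bij s' by (auto simp: bij_betw_def)
      ultimately show "y \<in> peirce M f" using f_sum[OF s'] s(2) by (simp add: peirce_def)
    next
      fix y assume y: "y \<in> peirce M f"
      then have "y \<in> ?sum ` (\<Pi>\<^sub>E j\<in>{..<l}. S j)" using bij by (simp add: bij_betw_def peirce_def)
      then obtain s where s: "s \<in> (\<Pi>\<^sub>E j\<in>{..<l}. S j)" "y = ?sum s" by blast
      \<comment> \<open>Applying \<open>f\<close> to the components yields a second decomposition of
        the same \<open>y\<close>, so uniqueness forces \<open>t = s\<close>.\<close>
      define t where "t = (\<lambda>j\<in>{..<l}. f \<odot>\<^bsub>M\<^esub> s j)"
      have t: "t \<in> (\<Pi>\<^sub>E j\<in>{..<l}. S j)" using s(1) S(2) by (auto simp: t_def)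
      have "?sum t = (\<Oplus>\<^bsub>M\<^esub>j\<in>{..<l}. f \<odot>\<^bsub>M\<^esub> s j)"
        by (rule M.finsum_cong') (use s(1) S(1)[THEN subsetD] assms(2) in \<open>auto simp: t_def PiE_iff\<close>)
      also have "\<dots> = ?sum s" using f_sum[OF s(1)] y s(2) by (simp add: peirce_def)
      finally have "t = s" using bij t s(1) by (auto simp: bij_betw_def dest: inj_onD)
      have "f \<odot>\<^bsub>M\<^esub> s j = s j" if "j < l" for j
        using fun_cong[OF \<open>t = s\<close>, of j] that by (simp add: t_def)
      then have "s \<in> (\<Pi>\<^sub>E j\<in>{..<l}. ?P j)" using s(1) by (auto simp: PiE_iff peirce_def)
      then show "y \<in> ?sum ` (\<Pi>\<^sub>E j\<in>{..<l}. ?P j)" using s(2) by blast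
    qed
  qed
  then have "card (peirce M f) = card (\<Pi>\<^sub>E j\<in>{..<l}. ?P j)" by (simp add: bij_betw_same_card)
  then show ?thesis by (simp add: card_PiE)
qed

text \<open>A summand that \<open>f\<close> does not kill is isomorphic to \<open>V\<close> by
  \<open>simple_modules_iso\<close>. So every summand isomorphic to \<open>V\<close> contributes the
  factor |fV| and every other one the factor 1.\<close>

lemma card_peirce_multiplicity:
  assumes "simple_decomposition R M l S" "finite (carrier R)" "primitive_idempotent R f"
    and V: "left_module R V" "simple_module R V" "peirce V f \<noteq> {\<zero>\<^bsub>V\<^esub>}"
  shows "card (peirce M f) = card (peirce V f) ^ card {j. j < l \<and> module_iso R (M\<lparr>carrier := S j\<rparr>) V}"
proof -
  note f = R.primitive_idempotentD[OF assms(3)]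
  let ?P = "\<lambda>j. peirce (M\<lparr>carrier := S j\<rparr>) f"
  let ?I = "\<lambda>j. module_iso R (M\<lparr>carrier := S j\<rparr>) V"
  interpret V: left_module R V by fact
  obtain v where v: "v \<in> peirce V f" "v \<noteq> \<zero>\<^bsub>V\<^esub>"
    using V(3) V.zero_in_peirce[OF f(1)] by blast
  have "card (?P j) = (if ?I j then card (peirce V f) else 1)" if "j < l" for j
  proof -
    note S = simple_decompositionD[OF assms(1) that]
    interpret S: left_module R "M\<lparr>carrier := S j\<rparr>" by (rule submodule_is_left_module[OF S(1)])
    show ?thesis
    proof (cases "?I j")
      case True
      then show ?thesis using module_iso_card_peirce[OF True f(1) S.left_module_axioms] by simp
    next
      case False
      have "?P j = {\<zero>\<^bsub>M\<^esub>}"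
      proof (rule ccontr)
        assume "?P j \<noteq> {\<zero>\<^bsub>M\<^esub>}"
        then obtain x where "x \<in> ?P j" "x \<noteq> \<zero>\<^bsub>M\<lparr>carrier := S j\<rparr>\<^esub>"
          using S.zero_in_peirce[OF f(1)] by auto
        then have "?I j"
          using simple_modules_iso[OF S.left_module_axioms S(2) V(1,2) assms(2,3) _ _ v] by blast
        then show False using False by simp
      qed
      then show ?thesis using False by simp
    qed
  qed
  then have "card (peirce M f) = (\<Prod>j<l. if ?I j then card (peirce V f) else 1)"
    unfolding card_peirce_decomposition[OF assms(1) f(1)] by (intro prod.cong) auto
  also have "\<dots> = (\<Prod>j\<in>{j \<in> {..<l}. ?I j}. card (peirce V f))"
    by (rule prod.inter_filter[symmetric]) simp
  also have "{j \<in> {..<l}. ?I j} = {j. j < l \<and> ?I j}" by auto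
  finally show ?thesis by simp
qed

text \<open>\<open>multiplicity_in\<close> takes its value from an arbitrarily chosen decomposition.
  The exponent c in |fM| = |fV|^c is determined because |fV| > 1, so every decomposition gives the
  same value: Krull-Schmidt uniqueness in counting form.\<close>

lemma multiplicity_in_eq:
  assumes "simple_decomposition R M l S" "finite (carrier R)" "primitive_idempotent R f"
    and V: "left_module R V" "simple_module R V" "peirce V f \<noteq> {\<zero>\<^bsub>V\<^esub>}" "finite (carrier V)"
  shows "multiplicity_in R M V = card {j. j < l \<and> module_iso R (M\<lparr>carrier := S j\<rparr>) V}"
proof -
  let ?c = "\<lambda>l S. card {j. j < l \<and> module_iso R (M\<lparr>carrier := S j\<rparr>) V}"
  interpret V: left_module R V by fact
  have zero: "\<zero>\<^bsub>V\<^esub> \<in> peirce V f"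
    using V.zero_in_peirce R.primitive_idempotentD(1)[OF assms(3)] by blast
  have "card (peirce V f) \<noteq> 0"
    using V(4) zero by (auto simp: peirce_def card_eq_0_iff)
  moreover have "card (peirce V f) \<noteq> 1"
    using V(3) zero by (metis card_1_singletonE singletonD)
  ultimately have q: "card (peirce V f) > 1" by simp
  have "\<exists>l' S'. simple_decomposition R M l' S' \<and> multiplicity_in R M V = ?c l' S'"
    unfolding multiplicity_in_def by (rule someI_ex) (use assms(1) in blast)
  then obtain l' S' where S': "simple_decomposition R M l' S'" "multiplicity_in R M V = ?c l' S'"
    by blast
  have "card (peirce V f) ^ ?c l' S' = card (peirce V f) ^ ?c l S"
    using card_peirce_multiplicity[OF S'(1) assms(2,3) V(1,2,3)]
      card_peirce_multiplicity[OF assms(1,2,3) V(1,2,3)] by simp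
  then show ?thesis using S'(2) power_inject_exp[OF q] by simp
qed

end

section \<open>Complete sets of orthogonal primitive idempotents and the decomposition of the
  top\<close>

locale primitive_decomposition = ring R for R (structure) +
  fixes m :: nat and e :: "nat \<Rightarrow> 'a"
  assumes finite_carrier: "finite (carrier R)"
    and primitive: "i < m \<Longrightarrow> primitive_idempotent R (e i)"
    and orthogonal: "\<lbrakk>i < m; j < m; i \<noteq> j\<rbrakk> \<Longrightarrow> e i \<otimes> e j = \<zero>"
    and sum_one: "(\<Oplus>i\<in>{..<m}. e i) = \<one>"
begin

lemma e_closed: "i < m \<Longrightarrow> e i \<in> carrier R"
  and e_idem: "i < m \<Longrightarrow> e i \<otimes> e i = e i"
  using primitive_idempotentD primitive by blast+

lemma finsum_component:
  assumes "a \<in> {..<m} \<rightarrow> carrier R" "\<And>j. j < m \<Longrightarrow> a j \<otimes> e j = a j" "k < m"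
  shows "(\<Oplus>j\<in>{..<m}. a j) \<otimes> e k = a k"
proof -
  have "(\<Oplus>j\<in>{..<m}. a j) \<otimes> e k = (\<Oplus>j\<in>{..<m}. a j \<otimes> e k)"
    by (rule finsum_ldistr) (use assms e_closed in auto)
  also have "\<dots> = (\<Oplus>j\<in>{..<m}. if k = j then a j else \<zero>)"
  proof (rule finsum_cong')
    fix j assume "j \<in> {..<m}"
    then have j: "j < m" "a j \<in> carrier R" using assms(1) by auto
    have "a j \<otimes> e k = a j \<otimes> (e j \<otimes> e k)"
      using assms(2)[OF j(1)] j e_closed[OF j(1)] e_closed[OF assms(3)] by (simp flip: m_assoc)
    then show "a j \<otimes> e k = (if k = j then a j else \<zero>)"
      using orthogonal[OF j(1) assms(3)] assms(2)[OF j(1)] j by (auto simp: e_idem)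
  qed (use assms(1) in auto)
  also have "\<dots> = a k" using assms by (intro finsum_singleton) auto
  finally show ?thesis .
qed

lemma peirce_component:
  assumes "left_module R M" "x \<in> (\<Pi> j\<in>{..<m}. peirce M (e j))" "k < m"
  shows "e k \<odot>\<^bsub>M\<^esub> (\<Oplus>\<^bsub>M\<^esub>j\<in>{..<m}. x j) = x k"
proof -
  interpret M: left_module R M by fact
  have x: "x j \<in> carrier M" "e j \<odot>\<^bsub>M\<^esub> x j = x j" if "j < m" for j
    using assms(2) that by (auto simp: Pi_iff peirce_def)
  have "e k \<odot>\<^bsub>M\<^esub> (\<Oplus>\<^bsub>M\<^esub>j\<in>{..<m}. x j) = (\<Oplus>\<^bsub>M\<^esub>j\<in>{..<m}. e k \<odot>\<^bsub>M\<^esub> x j)"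
    by (rule M.smult_finsum) (use x e_closed assms(3) in auto)
  also have "\<dots> = (\<Oplus>\<^bsub>M\<^esub>j\<in>{..<m}. if k = j then x j else \<zero>\<^bsub>M\<^esub>)"
  proof (rule M.M.finsum_cong')
    fix j assume "j \<in> {..<m}"
    then have j: "j < m" by simp
    have "e k \<odot>\<^bsub>M\<^esub> x j = (e k \<otimes> e j) \<odot>\<^bsub>M\<^esub> x j"
      using x[OF j] e_closed[OF j] e_closed[OF assms(3)] by (simp add: M.smult_assoc)
    then show "e k \<odot>\<^bsub>M\<^esub> x j = (if k = j then x j else \<zero>\<^bsub>M\<^esub>)"
      using orthogonal[OF assms(3) j] x[OF j] by auto
  qed (use x in auto)
  also have "\<dots> = x k" using assms(3) x by (intro M.M.finsum_singleton) auto
  finally show ?thesis .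
qed

text \<open>The subgroups e_j M are independent, as multiplication by e_k recovers the k-th summand,
  so the product of their sizes is at most |M|. Factors with e_j equivalent to e_i are at least |e_i
  M|; the others are at least 1 because they contain 0.\<close>

lemma card_ge_power:
  assumes "left_module R M" "finite (carrier M)" "i < m"
  shows "card (peirce M (e i)) ^ card {j. j < m \<and> equiv_idem R (e i) (e j)} \<le> card (carrier M)"
proof -
  interpret M: left_module R M by fact
  let ?P = "\<lambda>j. peirce M (e j)"
  let ?E = "\<lambda>j. equiv_idem R (e i) (e j)"
  have fin: "finite (?P j)" for j using assms(2) by (simp add: peirce_def)
  have "card (?P i) ^ card {j. j < m \<and> ?E j} = (\<Prod>j\<in>{j \<in> {..<m}. ?E j}. card (?P i))"
    by (auto intro: arg_cong[of _ _ "\<lambda>A. _ ^ card A"])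
  also have "\<dots> = (\<Prod>j<m. if ?E j then card (?P i) else 1)"
    by (rule prod.inter_filter) simp
  also have "\<dots> \<le> (\<Prod>j<m. card (?P j))"
  proof (rule prod_mono)
    fix j assume "j \<in> {..<m}"
    then have j: "j < m" by simp
    have "card (?P j) \<ge> 1"
      using M.zero_in_peirce[OF e_closed[OF j]] fin[of j] by (auto simp: Suc_le_eq card_gt_0_iff)
    then show "0 \<le> (if ?E j then card (?P i) else 1) \<and> (if ?E j then card (?P i) else 1) \<le> card (?P j)"
      using M.card_peirce_mono[OF _ e_closed[OF assms(3)] e_closed[OF j] assms(2)] by auto
  qed
  also have "\<dots> = card (\<Pi>\<^sub>E j\<in>{..<m}. ?P j)" by (simp add: card_PiE)
  also have "\<dots> \<le> card (carrier M)"
  proof (rule card_inj_on_le[of "\<lambda>x. \<Oplus>\<^bsub>M\<^esub>j\<in>{..<m}. x j"])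
    show "inj_on (\<lambda>x. \<Oplus>\<^bsub>M\<^esub>j\<in>{..<m}. x j) (\<Pi>\<^sub>E j\<in>{..<m}. ?P j)"
    proof (rule inj_onI)
      fix x y assume xy: "x \<in> (\<Pi>\<^sub>E j\<in>{..<m}. ?P j)" "y \<in> (\<Pi>\<^sub>E j\<in>{..<m}. ?P j)"
        "(\<Oplus>\<^bsub>M\<^esub>j\<in>{..<m}. x j) = (\<Oplus>\<^bsub>M\<^esub>j\<in>{..<m}. y j)"
      show "x = y"
      proof (rule PiE_ext[OF xy(1,2)])
        fix k assume "k \<in> {..<m}"
        then show "x k = y k"
          using peirce_component[OF assms(1), of x k] peirce_component[OF assms(1), of y k] xy
          by (auto simp: PiE_def)
      qed
    qed
    show "(\<lambda>x. \<Oplus>\<^bsub>M\<^esub>j\<in>{..<m}. x j) ` (\<Pi>\<^sub>E j\<in>{..<m}. ?P j) \<subseteq> carrier M"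
      by (auto intro!: M.M.finsum_closed simp: PiE_iff peirce_def)
  qed (rule assms(2))
  finally show ?thesis .
qed

text \<open>The image of R e_j modulo J is simple because any element of R e_j outside J generates
  e_j. The images span since the e_j sum to 1, and their sum is direct since right multiplication by
  e_k extracts the k-th component, also modulo J.\<close>

lemma top_decomposition:
  defines "S \<equiv> \<lambda>j. (\<lambda>x. jac_rad R +>\<^bsub>regular_module R\<^esub> x) ` principal_ideal R (e j)"
  shows "simple_decomposition R (top_module R (regular_module R)) m S"
    and "\<And>j. j < m \<Longrightarrow> peirce ((top_module R (regular_module R))\<lparr>carrier := S j\<rparr>) (e j) \<noteq> {\<zero>\<^bsub>top_module R (regular_module R)\<^esub>}"
proof -
  let ?A = "regular_module R" and ?J = "jac_rad R"
  let ?Q = "top_module R ?A"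
  interpret A: left_module R ?A by (rule regular_left_module)
  have Q_eq: "?Q = quot_module ?A ?J" by (simp add: top_module_def)
  note Jsub = jac_rad_submodule
  interpret Q: left_module R ?Q unfolding Q_eq by (rule A.quot_module_is_left_module[OF Jsub])
  define c where "c x = ?J +>\<^bsub>?A\<^esub> x" for x
  have c_carrier: "carrier ?Q = c ` carrier R" and c_0: "\<zero>\<^bsub>?Q\<^esub> = ?J"
    by (simp_all add: Q_eq A.quot_module_simps c_def)
  have c_add: "c x \<oplus>\<^bsub>?Q\<^esub> c y = c (x \<oplus> y)" if "x \<in> carrier R" "y \<in> carrier R" for x y
    using A.quot_module_add[OF Jsub, of x y] that by (simp add: Q_eq c_def)
  have c_smult: "r \<odot>\<^bsub>?Q\<^esub> c x = c (r \<otimes> x)" if "r \<in> carrier R" "x \<in> carrier R" for r x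
    using A.quot_module_smult[OF Jsub, of r x] that by (simp add: Q_eq c_def)
  have c_eq_0: "c x = ?J \<longleftrightarrow> x \<in> ?J" if "x \<in> carrier R" for x
    using A.coset_eq_zero_iff[OF Jsub, of x] that by (simp add: c_def)
  \<comment> \<open>Right multiplication descends to the quotient because J is also a right ideal;
    the left-module structure of \<open>?Q\<close> alone does not provide this.\<close>
  have c_eq_smult: "c (x \<otimes> r) = c (y \<otimes> r)"
    if "c x = c y" "x \<in> carrier R" "y \<in> carrier R" "r \<in> carrier R" for x y r
  proof -
    have "c (x \<ominus> y) = c x \<oplus>\<^bsub>?Q\<^esub> c (\<ominus> y)" using that(2,3) by (simp add: c_add minus_eq)
    also have "\<dots> = c (y \<ominus> y)" unfolding that(1) using that(3) by (simp add: c_add minus_eq)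
    also have "\<dots> = ?J" using that c_eq_0[of \<zero>] regular_submoduleD(2)[OF Jsub] by (simp add: minus_eq r_neg)
    finally have "x \<ominus> y \<in> ?J" using c_eq_0 that by simp
    then have xyr: "(x \<ominus> y) \<otimes> r \<in> ?J" using that(4) by (rule jac_rad_right)
    have "c (x \<otimes> r) = c ((x \<ominus> y) \<otimes> r \<oplus> y \<otimes> r)"
      using that by (simp add: minus_eq l_distr a_assoc l_minus l_neg)
    also have "\<dots> = \<zero>\<^bsub>?Q\<^esub> \<oplus>\<^bsub>?Q\<^esub> c (y \<otimes> r)"
      using that xyr c_eq_0[of "(x \<ominus> y) \<otimes> r"] c_add[of "(x \<ominus> y) \<otimes> r" "y \<otimes> r"] by (simp add: c_0)
    also have "\<dots> = c (y \<otimes> r)"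
      by (rule Q.M.l_zero) (use that in \<open>simp add: c_carrier\<close>)
    finally show ?thesis .
  qed
  have c_finsum: "(\<Oplus>\<^bsub>?Q\<^esub>j\<in>{..<m}. c (a j)) = c (\<Oplus>j\<in>{..<m}. a j)" if "a \<in> {..<m} \<rightarrow> carrier R" for a
    using A.quot_module_finsum[OF Jsub, of "{..<m}" a] that by (simp add: Q_eq c_def)
  have S: "S j = c ` principal_ideal R (e j)" for j by (simp add: S_def c_def[abs_def])
  have I: "x \<in> principal_ideal R (e j) \<longleftrightarrow> x \<in> carrier R \<and> x \<otimes> e j = x" if "j < m" for j x
    by (rule principal_ideal_iff) (use e_closed[OF that] e_idem[OF that] in auto)
  have S_sub: "submodule (S j) R ?Q" if j: "j < m" for j
  proof -
    note P = regular_submoduleD[OF principal_submodule[OF e_closed[OF j]]]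
    show ?thesis
    proof (rule Q.submoduleI)
      show "S j \<subseteq> carrier ?Q" unfolding S c_carrier by (rule image_mono[OF P(1)])
      have "?J = c \<zero>" using c_eq_0[of \<zero>] regular_submoduleD(2)[OF Jsub] by simp
      then show "\<zero>\<^bsub>?Q\<^esub> \<in> S j" unfolding S c_0 by (rule image_eqI) (rule P(2))
    next
      fix X Y assume X: "X \<in> S j" and Y: "Y \<in> S j"
      obtain x where x: "X = c x" "x \<in> principal_ideal R (e j)" using X unfolding S by (rule imageE)
      obtain y where y: "Y = c y" "y \<in> principal_ideal R (e j)" using Y unfolding S by (rule imageE)
      have "X \<oplus>\<^bsub>?Q\<^esub> Y = c (x \<oplus> y)"
        unfolding x(1) y(1) by (rule c_add[OF subsetD[OF P(1) x(2)] subsetD[OF P(1) y(2)]])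
      then show "X \<oplus>\<^bsub>?Q\<^esub> Y \<in> S j" unfolding S by (rule image_eqI) (rule P(3)[OF x(2) y(2)])
    next
      fix r X assume r: "r \<in> carrier R" and X: "X \<in> S j"
      obtain x where x: "X = c x" "x \<in> principal_ideal R (e j)" using X unfolding S by (rule imageE)
      have "r \<odot>\<^bsub>?Q\<^esub> X = c (r \<otimes> x)"
        unfolding x(1) by (rule c_smult[OF r subsetD[OF P(1) x(2)]])
      then show "r \<odot>\<^bsub>?Q\<^esub> X \<in> S j" unfolding S by (rule image_eqI) (rule P(4)[OF r x(2)])
    qed
  qed
  have ce: "c (e j) \<in> S j" "c (e j) \<noteq> \<zero>\<^bsub>?Q\<^esub>" if "j < m" for j
  proof -
    show "c (e j) \<in> S j" using I[OF that] e_closed[OF that] e_idem[OF that] unfolding S by (intro imageI) simp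
    show "c (e j) \<noteq> \<zero>\<^bsub>?Q\<^esub>"
      using c_eq_0[OF e_closed[OF that]] primitive_not_in_jac_rad[OF finite_carrier primitive[OF that]]
      by (simp add: c_0)
  qed
  have S_simple: "simple_module R (?Q\<lparr>carrier := S j\<rparr>)" if j: "j < m" for j
  proof -
    interpret S: left_module R "?Q\<lparr>carrier := S j\<rparr>" by (rule Q.submodule_is_left_module[OF S_sub[OF j]])
    have "\<exists>r\<in>carrier R. Y = r \<odot>\<^bsub>?Q\<^esub> X" if X: "X \<in> S j" "X \<noteq> \<zero>\<^bsub>?Q\<^esub>" and Y: "Y \<in> S j" for X Y
    proof -
      obtain x where Xx: "X = c x" "x \<in> principal_ideal R (e j)" using X(1) unfolding S by (rule imageE)
      obtain y where Yy: "Y = c y" "y \<in> principal_ideal R (e j)" using Y unfolding S by (rule imageE)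
      have x: "x \<in> carrier R" "x \<otimes> e j = x" and y: "y \<in> carrier R" "y \<otimes> e j = y"
        using Xx(2) Yy(2) by (simp_all only: I[OF j])
      have "x \<notin> ?J" using X(2) Xx(1) c_eq_0[OF x(1)] by (simp add: c_0)
      moreover have "x \<in> principal_ideal R x" using A.self_in_cyclic[of x] x(1) by simp
      ultimately have "e j \<in> principal_ideal R x"
        by (intro primitive_in_submodule[OF finite_carrier primitive[OF j] principal_submodule[OF x(1)] _ x(2)])
      then obtain r where r: "r \<in> carrier R" "e j = r \<otimes> x" by blast
      \<comment> \<open>Here y = y e_j and e_j = rx.\<close>
      have "Y = c ((y \<otimes> r) \<otimes> x)" using Yy(1) y r x by (simp add: m_assoc)
      also have "\<dots> = (y \<otimes> r) \<odot>\<^bsub>?Q\<^esub> X" using c_smult[of "y \<otimes> r" x] Xx(1) y(1) r(1) x(1) by simp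
      finally show ?thesis using y(1) r(1) by blast
    qed
    then show ?thesis
      unfolding S.simple_module_iff using ce[OF j] by auto
  qed
  have bij: "bij_betw (\<lambda>s. \<Oplus>\<^bsub>?Q\<^esub>j\<in>{..<m}. s j) (\<Pi>\<^sub>E j\<in>{..<m}. S j) (carrier ?Q)"
  proof (rule bij_betw_imageI)
    \<comment> \<open>A family of cosets is lifted to elements a_j of R e_j all at once, so that an
      equality of sums in the quotient can be multiplied by \<open>e k\<close> on the right.\<close>
    have lift: "\<exists>a. (\<forall>j<m. a j \<in> carrier R \<and> a j \<otimes> e j = a j \<and> s j = c (a j)) \<and>
        (\<Oplus>\<^bsub>?Q\<^esub>j\<in>{..<m}. s j) = c (\<Oplus>j\<in>{..<m}. a j)" if s: "s \<in> (\<Pi>\<^sub>E j\<in>{..<m}. S j)" for s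
    proof -
      have "\<forall>j\<in>{..<m}. \<exists>x. x \<in> carrier R \<and> x \<otimes> e j = x \<and> s j = c x"
      proof
        fix j assume j: "j \<in> {..<m}"
        then have "s j \<in> S j" using s by (auto simp: PiE_iff)
        then obtain x where x: "s j = c x" "x \<in> principal_ideal R (e j)" unfolding S by (rule imageE)
        then have "x \<in> carrier R \<and> x \<otimes> e j = x \<and> s j = c x" using j by (simp only: I lessThan_iff)
        then show "\<exists>x. x \<in> carrier R \<and> x \<otimes> e j = x \<and> s j = c x" ..
      qed
      then obtain a where a: "\<forall>j\<in>{..<m}. a j \<in> carrier R \<and> a j \<otimes> e j = a j \<and> s j = c (a j)"
        by (rule bchoice[THEN exE])
      have "(\<Oplus>\<^bsub>?Q\<^esub>j\<in>{..<m}. s j) = (\<Oplus>\<^bsub>?Q\<^esub>j\<in>{..<m}. c (a j))"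
        by (rule Q.M.finsum_cong') (use a in \<open>auto simp: c_carrier\<close>)
      also have "\<dots> = c (\<Oplus>j\<in>{..<m}. a j)" by (rule c_finsum) (use a in auto)
      finally show ?thesis using a by (intro exI[of _ a]) simp
    qed
    show "inj_on (\<lambda>s. \<Oplus>\<^bsub>?Q\<^esub>j\<in>{..<m}. s j) (\<Pi>\<^sub>E j\<in>{..<m}. S j)"
    proof (rule inj_onI)
      fix s t assume st: "s \<in> (\<Pi>\<^sub>E j\<in>{..<m}. S j)" "t \<in> (\<Pi>\<^sub>E j\<in>{..<m}. S j)"
        "(\<Oplus>\<^bsub>?Q\<^esub>j\<in>{..<m}. s j) = (\<Oplus>\<^bsub>?Q\<^esub>j\<in>{..<m}. t j)"
      obtain a where a: "\<forall>j<m. a j \<in> carrier R \<and> a j \<otimes> e j = a j \<and> s j = c (a j)"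
        "(\<Oplus>\<^bsub>?Q\<^esub>j\<in>{..<m}. s j) = c (\<Oplus>j\<in>{..<m}. a j)" using lift[OF st(1)] by blast
      obtain b where b: "\<forall>j<m. b j \<in> carrier R \<and> b j \<otimes> e j = b j \<and> t j = c (b j)"
        "(\<Oplus>\<^bsub>?Q\<^esub>j\<in>{..<m}. t j) = c (\<Oplus>j\<in>{..<m}. b j)" using lift[OF st(2)] by blast
      have closed: "(\<Oplus>j\<in>{..<m}. a j) \<in> carrier R" "(\<Oplus>j\<in>{..<m}. b j) \<in> carrier R"
        using a b by (auto intro!: finsum_closed)
      show "s = t"
      proof (rule PiE_ext[OF st(1,2)])
        fix k assume "k \<in> {..<m}"
        then have k: "k < m" by simp
        have "c ((\<Oplus>j\<in>{..<m}. a j) \<otimes> e k) = c ((\<Oplus>j\<in>{..<m}. b j) \<otimes> e k)"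
          using c_eq_smult[OF _ closed e_closed[OF k]] a(2) b(2) st(3) by simp
        moreover have "(\<Oplus>j\<in>{..<m}. a j) \<otimes> e k = a k"
          by (rule finsum_component[OF _ _ k]) (use a in auto)
        moreover have "(\<Oplus>j\<in>{..<m}. b j) \<otimes> e k = b k"
          by (rule finsum_component[OF _ _ k]) (use b in auto)
        ultimately show "s k = t k" using a(1) b(1) k by simp
      qed
    qed
    show "(\<lambda>s. \<Oplus>\<^bsub>?Q\<^esub>j\<in>{..<m}. s j) ` (\<Pi>\<^sub>E j\<in>{..<m}. S j) = carrier ?Q"
    proof (intro equalityI subsetI)
      fix X assume "X \<in> (\<lambda>s. \<Oplus>\<^bsub>?Q\<^esub>j\<in>{..<m}. s j) ` (\<Pi>\<^sub>E j\<in>{..<m}. S j)"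
      then show "X \<in> carrier ?Q"
        using Q.submoduleD(1)[OF S_sub] by (fastforce intro!: Q.M.finsum_closed simp: PiE_iff)
    next
      fix X assume "X \<in> carrier ?Q"
      then obtain x where x: "x \<in> carrier R" "X = c x" unfolding c_carrier by blast
      define s where "s = (\<lambda>j\<in>{..<m}. c (x \<otimes> e j))"
      have "c (x \<otimes> e j) \<in> S j" if "j < m" for j
        unfolding S by (rule imageI) (use x(1) in blast)
      then have s: "s \<in> (\<Pi>\<^sub>E j\<in>{..<m}. S j)" by (simp add: s_def)
      have "(\<Oplus>\<^bsub>?Q\<^esub>j\<in>{..<m}. s j) = (\<Oplus>\<^bsub>?Q\<^esub>j\<in>{..<m}. c (x \<otimes> e j))"
        by (rule Q.M.finsum_cong') (use x(1) e_closed in \<open>auto simp: s_def c_carrier\<close>)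
      also have "\<dots> = c (\<Oplus>j\<in>{..<m}. x \<otimes> e j)" by (rule c_finsum) (use x(1) e_closed in auto)
      also have "(\<Oplus>j\<in>{..<m}. x \<otimes> e j) = x \<otimes> (\<Oplus>j\<in>{..<m}. e j)"
        by (rule finsum_rdistr[symmetric]) (use x(1) e_closed in auto)
      also have "\<dots> = x" using x(1) by (simp add: sum_one)
      finally show "X \<in> (\<lambda>s. \<Oplus>\<^bsub>?Q\<^esub>j\<in>{..<m}. s j) ` (\<Pi>\<^sub>E j\<in>{..<m}. S j)" using s x(2) by force
    qed
  qed
  show "simple_decomposition R ?Q m S"
    using S_sub S_simple bij by (simp add: simple_decomposition_def simple_submodule_def)
  show "peirce (?Q\<lparr>carrier := S j\<rparr>) (e j) \<noteq> {\<zero>\<^bsub>?Q\<^esub>}" if j: "j < m" for j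
  proof -
    have "c (e j) \<in> peirce (?Q\<lparr>carrier := S j\<rparr>) (e j)"
      using ce(1)[OF j] c_smult[OF e_closed[OF j] e_closed[OF j]] e_idem[OF j] by (simp add: peirce_def)
    then show ?thesis using ce(2)[OF j] by blast
  qed
qed

text \<open>The summands of the top are indexed by the idempotents, and the j-th one is not killed
  by e_j. It is therefore isomorphic to V = top(R e_i) exactly when e_j V is nonzero. As e_i V is
  nonzero too, this means that e_i and e_j are equivalent.\<close>

lemma multiplicity_in_top:
  assumes "i < m"
  shows "multiplicity_in R (top_module R (regular_module R)) (top_module R (principal_module R (e i))) =
    card {j. j < m \<and> equiv_idem R (e i) (e j)}"
proof -
  let ?Q = "top_module R (regular_module R)" and ?V = "top_module R (principal_module R (e i))"
  obtain S where S: "simple_decomposition R ?Q m S"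
    "\<And>j. j < m \<Longrightarrow> peirce (?Q\<lparr>carrier := S j\<rparr>) (e j) \<noteq> {\<zero>\<^bsub>?Q\<^esub>}"
    using top_decomposition by blast
  note V = top_principal[OF finite_carrier primitive[OF assms]]
  interpret Q: left_module R ?Q
    unfolding top_module_def
    by (rule left_module.quot_module_is_left_module[OF regular_left_module jac_rad_submodule])
  interpret V: left_module R ?V by (rule V(1))
  have "module_iso R (?Q\<lparr>carrier := S j\<rparr>) ?V \<longleftrightarrow> equiv_idem R (e i) (e j)" if j: "j < m" for j
  proof -
    let ?S = "?Q\<lparr>carrier := S j\<rparr>"
    note Sj = Q.simple_decompositionD[OF S(1) j]
    interpret S: left_module R ?S by (rule Q.submodule_is_left_module[OF Sj(1)])
    obtain s where s: "s \<in> peirce ?S (e j)" "s \<noteq> \<zero>\<^bsub>?S\<^esub>"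
      using S(2)[OF j] S.zero_in_peirce[OF e_closed[OF j]] by auto
    obtain v where v: "v \<in> peirce ?V (e i)" "v \<noteq> \<zero>\<^bsub>?V\<^esub>"
      using V(3) V.zero_in_peirce[OF e_closed[OF assms]] by auto
    show ?thesis
    proof
      assume iso: "module_iso R ?S ?V"
      have "finite (peirce ?V (e j))" using V(4) by (simp add: peirce_def)
      have "peirce ?V (e j) \<noteq> {\<zero>\<^bsub>?V\<^esub>}"
      proof
        assume "peirce ?V (e j) = {\<zero>\<^bsub>?V\<^esub>}"
        then have "card (peirce ?S (e j)) = 1"
          using module_iso_card_peirce[OF iso e_closed[OF j] S.left_module_axioms] by simp
        then show False
          using s S.zero_in_peirce[OF e_closed[OF j]] by (auto simp: card_1_singleton_iff)
      qed
      then obtain w where w: "w \<in> peirce ?V (e j)" "w \<noteq> \<zero>\<^bsub>?V\<^esub>"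
        using V.zero_in_peirce[OF e_closed[OF j]] by auto
      show "equiv_idem R (e i) (e j)"
        by (rule V.simple_module_equiv_idem[OF V(2) finite_carrier primitive[OF assms] primitive[OF j] v w])
    next
      assume "equiv_idem R (e i) (e j)"
      then have "peirce ?V (e j) \<noteq> {\<zero>\<^bsub>?V\<^esub>}"
        using V.peirce_nontrivial_mono[OF _ e_closed[OF assms] e_closed[OF j] V(3)] by blast
      then obtain w where w: "w \<in> peirce ?V (e j)" "w \<noteq> \<zero>\<^bsub>?V\<^esub>"
        using V.zero_in_peirce[OF e_closed[OF j]] by auto
      show "module_iso R ?S ?V"
        by (rule simple_modules_iso[OF S.left_module_axioms Sj(2) V(1,2) finite_carrier primitive[OF j] s w])
    qed
  qed
  then have "{j. j < m \<and> module_iso R (?Q\<lparr>carrier := S j\<rparr>) ?V} = {j. j < m \<and> equiv_idem R (e i) (e j)}"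
    by blast
  then show ?thesis
    using Q.multiplicity_in_eq[OF S(1) finite_carrier primitive[OF assms] V] by simp
qed

end

subsection \<open>The opposite ring\<close>

lemma opp_ring_simps [simp]:
  "carrier (opp_ring R) = carrier R" "\<zero>\<^bsub>opp_ring R\<^esub> = \<zero>\<^bsub>R\<^esub>" "\<one>\<^bsub>opp_ring R\<^esub> = \<one>\<^bsub>R\<^esub>"
  "x \<oplus>\<^bsub>opp_ring R\<^esub> y = x \<oplus>\<^bsub>R\<^esub> y" "x \<otimes>\<^bsub>opp_ring R\<^esub> y = y \<otimes>\<^bsub>R\<^esub> x"
  by (simp_all add: opp_ring_def)

lemma finsum_opp_ring [simp]: "finsum (opp_ring R) = finsum R"
  by (simp add: opp_ring_def finsum_def finprod_def fun_eq_iff)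

lemma primitive_idempotent_opp_ring [simp]:
  "primitive_idempotent (opp_ring R) e \<longleftrightarrow> primitive_idempotent R e"
  by (auto simp: primitive_idempotent_def idempotent_in_def orthogonal_in_def)

text \<open>Passing to the opposite ring exchanges the roles of \<open>a\<close> and
  \<open>b\<close>. This symmetry carries multiplicities of right modules over to left
  modules.\<close>

lemma equiv_idem_opp_ring [simp]: "equiv_idem (opp_ring R) e f \<longleftrightarrow> equiv_idem R e f"
  unfolding equiv_idem_def by (simp, blast)

context ring
begin

lemma ring_opp_ring: "ring (opp_ring R)"
proof (rule ringI)
  show "abelian_group (opp_ring R)"
  proof (rule abelian_groupI)
    fix x assume "x \<in> carrier (opp_ring R)"
    then show "\<exists>y\<in>carrier (opp_ring R). y \<oplus>\<^bsub>opp_ring R\<^esub> x = \<zero>\<^bsub>opp_ring R\<^esub>"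
      by (intro bexI[of _ "\<ominus> x"]) (simp_all add: l_neg)
  qed (simp_all add: a_ac)
  show "monoid (opp_ring R)" by (rule monoidI) (simp_all add: m_assoc)
qed (simp_all add: l_distr r_distr)

lemma principal_module_simps:
  "carrier (principal_module R e) = principal_ideal R e"
  "\<zero>\<^bsub>principal_module R e\<^esub> = \<zero>"
  "x \<oplus>\<^bsub>principal_module R e\<^esub> y = x \<oplus> y"
  "r \<odot>\<^bsub>principal_module R e\<^esub> y = r \<otimes> y"
  by (simp_all add: principal_module_def)

text \<open>From an isomorphism, \<open>a\<close> is the image of \<open>e\<close> and
  \<open>b\<close> the preimage of \<open>f\<close>. Conversely, right multiplications by
  \<open>a\<close> and by \<open>b\<close> are mutually inverse.\<close>

lemma principal_modules_iso_iff:
  assumes "primitive_idempotent R e" "primitive_idempotent R f"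
  shows "module_iso R (principal_module R e) (principal_module R f) \<longleftrightarrow> equiv_idem R e f"
proof
  note e = primitive_idempotentD[OF assms(1)] and f = primitive_idempotentD[OF assms(2)]
  note Ie = principal_ideal_iff[OF e(1,2)] and If = principal_ideal_iff[OF f(1,2)]
  note simps = principal_module_simps
  {
    assume "module_iso R (principal_module R e) (principal_module R f)"
    then obtain \<phi> where bij: "bij_betw \<phi> (principal_ideal R e) (principal_ideal R f)"
      and lin: "\<And>r x. \<lbrakk>r \<in> carrier R; x \<in> principal_ideal R e\<rbrakk> \<Longrightarrow> \<phi> (r \<otimes> x) = r \<otimes> \<phi> x"
      by (rule module_isoD) (simp only: simps)
    have eI: "e \<in> principal_ideal R e" and fI: "f \<in> principal_ideal R f"
      unfolding Ie If using e f by auto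
    define a where "a = \<phi> e"
    have "a \<in> principal_ideal R f" unfolding a_def by (rule bij_betwE[OF bij, rule_format, OF eI])
    then have a: "a \<in> carrier R" "a \<otimes> f = a" unfolding If by auto
    have "f \<in> \<phi> ` principal_ideal R e" using bij fI by (simp only: bij_betw_def)
    then obtain b where b': "f = \<phi> b" "b \<in> principal_ideal R e" by (rule imageE)
    then have b: "b \<in> carrier R" "b \<otimes> e = b" unfolding Ie by auto
    have inj: "x = y" if "\<phi> x = \<phi> y" "x \<in> principal_ideal R e" "y \<in> principal_ideal R e" for x y
      using bij that by (auto simp only: bij_betw_def dest: inj_onD)
    have ea: "e \<otimes> a = a" using lin[OF e(1) eI] e(2) by (simp add: a_def)
    have fb: "f \<otimes> b = b"
    proof (rule inj)
      show "\<phi> (f \<otimes> b) = \<phi> b" using lin[OF f(1) b'(2)] f(2) by (simp flip: b'(1))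
    qed (use b f(1) e(1) in \<open>auto simp only: Ie m_assoc m_closed\<close>)
    have ab: "a \<otimes> b = e"
    proof (rule inj)
      show "\<phi> (a \<otimes> b) = \<phi> e" using lin[OF a(1) b'(2)] a(2) by (simp add: a_def flip: b'(1))
    qed (use a b e in \<open>auto simp only: Ie m_assoc m_closed\<close>)
    have "b \<otimes> a = f" using lin[OF b(1) eI] b(2) by (simp add: a_def flip: b'(1))
    then show "equiv_idem R e f" using a b ea fb ab unfolding equiv_idem_def by blast
  next
    assume "equiv_idem R e f"
    then obtain a b where ab: "a \<in> carrier R" "b \<in> carrier R" "e \<otimes> a = a" "a \<otimes> f = a" "f \<otimes> b = b"
      "b \<otimes> e = b" "a \<otimes> b = e" "b \<otimes> a = f"
      unfolding equiv_idem_def by blast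
    show "module_iso R (principal_module R e) (principal_module R f)"
    proof (rule module_isoI[of "\<lambda>x. x \<otimes> a"])
      show "bij_betw (\<lambda>x. x \<otimes> a) (carrier (principal_module R e)) (carrier (principal_module R f))"
        unfolding simps
      proof (rule bij_betw_byWitness[of _ "\<lambda>y. y \<otimes> b"])
        show "\<forall>x\<in>principal_ideal R e. (x \<otimes> a) \<otimes> b = x"
          unfolding Ball_def Ie using ab by (simp add: m_assoc)
        show "\<forall>y\<in>principal_ideal R f. (y \<otimes> b) \<otimes> a = y"
          unfolding Ball_def If using ab by (simp add: m_assoc)
        show "(\<lambda>x. x \<otimes> a) ` principal_ideal R e \<subseteq> principal_ideal R f"
          unfolding image_subset_iff Ball_def Ie If using ab f(1) by (simp add: m_assoc)
        show "(\<lambda>y. y \<otimes> b) ` principal_ideal R f \<subseteq> principal_ideal R e"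
          unfolding image_subset_iff Ball_def Ie If using ab e(1) by (simp add: m_assoc)
      qed
    qed (simp_all only: simps Ie l_distr m_assoc ab(1))
  }
qed

end

section \<open>Socles, and components with respect to the idempotents \<open>e i\<close>\<close>

lemma (in left_module) soc_submodule: "submodule (carrier (soc_module R M)) R M"
proof -
  let ?F = "{N. submodule N R M \<and> (\<forall>S. simple_submodule S R M \<longrightarrow> S \<subseteq> N)}"
  have "carrier M \<in> ?F"
    using submodule_carrier submoduleD(1) by (auto simp: simple_submodule_def)
  then have "\<Inter> ?F \<subseteq> carrier M" by (rule Inter_lower)
  then show ?thesis
    unfolding soc_module_def by (intro submoduleI) (auto dest: submoduleD)
qed

lemma (in left_module) simple_submodule_in_soc:
  "simple_submodule S R M \<Longrightarrow> S \<subseteq> carrier (soc_module R M)"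
  by (auto simp: soc_module_def)

context primitive_decomposition
begin

lemma exists_component:
  assumes "left_module R M" "x \<in> carrier M" "x \<noteq> \<zero>\<^bsub>M\<^esub>"
  obtains i where "i < m" "e i \<odot>\<^bsub>M\<^esub> x \<noteq> \<zero>\<^bsub>M\<^esub>"
proof -
  interpret M: left_module R M by fact
  have "\<exists>i<m. e i \<odot>\<^bsub>M\<^esub> x \<noteq> \<zero>\<^bsub>M\<^esub>"
  proof (rule ccontr)
    assume neg: "\<not> (\<exists>i<m. e i \<odot>\<^bsub>M\<^esub> x \<noteq> \<zero>\<^bsub>M\<^esub>)"
    have "x = (\<Oplus>i\<in>{..<m}. e i) \<odot>\<^bsub>M\<^esub> x" using assms(2) by (simp add: sum_one)
    also have "\<dots> = (\<Oplus>\<^bsub>M\<^esub>i\<in>{..<m}. e i \<odot>\<^bsub>M\<^esub> x)"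
      by (rule M.finsum_smult) (use assms(2) e_closed in auto)
    also have "\<dots> = (\<Oplus>\<^bsub>M\<^esub>i\<in>{..<m}. \<zero>\<^bsub>M\<^esub>)"
      by (rule M.M.finsum_cong') (use neg in auto)
    finally show False using assms(3) by simp
  qed
  then show thesis using that by blast
qed

text \<open>As the e_l sum to 1, an element of \<open>T\<close> is determined by its right
  components v e_l, which stay in \<open>T\<close>.\<close>

lemma card_le_prod_components:
  assumes "T \<subseteq> carrier R" "\<And>v r. \<lbrakk>v \<in> T; r \<in> carrier R\<rbrakk> \<Longrightarrow> v \<otimes> r \<in> T"
  shows "card T \<le> (\<Prod>l<m. card {w \<in> T. w \<otimes> e l = w})"
proof -
  let ?T = "\<lambda>l. {w \<in> T. w \<otimes> e l = w}"
  have fin: "finite T" using assms(1) finite_carrier by (rule finite_subset)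
  have comp: "v = (\<Oplus>l\<in>{..<m}. v \<otimes> e l)" if "v \<in> T" for v
  proof -
    have v: "v \<in> carrier R" using that assms(1) by blast
    have "v = v \<otimes> (\<Oplus>l\<in>{..<m}. e l)" using v by (simp add: sum_one)
    also have "\<dots> = (\<Oplus>l\<in>{..<m}. v \<otimes> e l)"
      by (rule finsum_rdistr) (use v e_closed in auto)
    finally show ?thesis .
  qed
  have "card T \<le> card (\<Pi>\<^sub>E l\<in>{..<m}. ?T l)"
  proof (rule card_inj_on_le[of "\<lambda>v. \<lambda>l\<in>{..<m}. v \<otimes> e l"])
    show "inj_on (\<lambda>v. \<lambda>l\<in>{..<m}. v \<otimes> e l) T"
    proof (rule inj_onI)
      fix v w assume vw: "v \<in> T" "w \<in> T" "(\<lambda>l\<in>{..<m}. v \<otimes> e l) = (\<lambda>l\<in>{..<m}. w \<otimes> e l)"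
      have "v \<otimes> e l = w \<otimes> e l" if "l < m" for l using fun_cong[OF vw(3), of l] that by simp
      then have "(\<Oplus>l\<in>{..<m}. v \<otimes> e l) = (\<Oplus>l\<in>{..<m}. w \<otimes> e l)"
        using vw(2) assms(1) e_closed by (intro finsum_cong') auto
      then show "v = w" using comp[OF vw(1)] comp[OF vw(2)] by simp
    qed
    show "(\<lambda>v. \<lambda>l\<in>{..<m}. v \<otimes> e l) ` T \<subseteq> (\<Pi>\<^sub>E l\<in>{..<m}. ?T l)"
    proof (rule image_subsetI)
      fix v assume v: "v \<in> T"
      then have "v \<in> carrier R" using assms(1) by blast
      then show "(\<lambda>l\<in>{..<m}. v \<otimes> e l) \<in> (\<Pi>\<^sub>E l\<in>{..<m}. ?T l)"
        using assms(2)[OF v] e_closed e_idem by (simp add: restrict_PiE_iff m_assoc)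
    qed
    show "finite (\<Pi>\<^sub>E l\<in>{..<m}. ?T l)" using fin by (intro finite_PiE) auto
  qed
  then show ?thesis by (simp add: card_PiE)
qed

end

subsection \<open>Homomorphisms from a simple module to a Frobenius ring\<close>

text \<open>The Frobenius condition in terms of left modules and \<open>equiv_idem\<close>.
  \<open>card_class\<close> is the equality of the multiplicities at \<open>i\<close> and
  \<open>\<pi> i\<close>, each expressed as the size of a class by
  \<open>multiplicity_in_top\<close>. In \<open>soc_iso_top\<close> the permuted index sits on the
  socle, so finding the top that matches a given socle requires the inverse of
  \<open>\<pi>\<close>.\<close>

locale frobenius_decomposition = primitive_decomposition +
  fixes k :: nat and \<pi> :: "nat \<Rightarrow> nat"
  assumes k_le: "k \<le> m"
    and inequivalent: "\<lbrakk>i < k; j < k; equiv_idem R (e i) (e j)\<rbrakk> \<Longrightarrow> i = j"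
    and representative: "i < m \<Longrightarrow> \<exists>j<k. equiv_idem R (e i) (e j)"
    and permutes: "\<pi> permutes {..<k}"
    and soc_iso_top: "i < k \<Longrightarrow> module_iso R (soc_module R (principal_module R (e (\<pi> i))))
      (top_module R (principal_module R (e i)))"
    and card_class: "i < k \<Longrightarrow> card {l. l < m \<and> equiv_idem R (e i) (e l)} =
      card {l. l < m \<and> equiv_idem R (e (\<pi> i)) (e l)}"
begin

text \<open>Whatever annihilates \<open>x\<close> annihilates \<open>w\<close>, so rx \<mapsto> rw
  is a homomorphism from the simple module \<open>S\<close> onto Rw, and it is nonzero.\<close>

lemma annihilated_simple:
  assumes "left_module R S" "simple_module R S" "x \<in> carrier S"
    and w: "w \<in> carrier R" "w \<noteq> \<zero>" "w \<otimes> e t = w" and t: "t < m"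
    and ann: "\<And>r. \<lbrakk>r \<in> carrier R; r \<odot>\<^bsub>S\<^esub> x = \<zero>\<^bsub>S\<^esub>\<rbrakk> \<Longrightarrow> r \<otimes> w = \<zero>"
  shows "simple_submodule (principal_ideal R w) R (principal_module R (e t))"
proof -
  interpret S: left_module R S by fact
  interpret P: left_module R "principal_module R (e t)"
    by (rule principal_left_module[OF e_closed[OF t]])
  have "w \<in> carrier (principal_module R (e t))"
    unfolding principal_module_simps principal_ideal_iff[OF e_closed[OF t] e_idem[OF t]] using w by simp
  from P.cyclic_submodule[OF this] have sub: "submodule (principal_ideal R w) R (principal_module R (e t))"
    by (simp only: principal_module_simps)
  interpret W: left_module R "(principal_module R (e t))\<lparr>carrier := principal_ideal R w\<rparr>"
    by (rule P.submodule_is_left_module[OF sub])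
  have self: "w \<in> principal_ideal R w"
    using left_module.self_in_cyclic[OF regular_left_module, of w] w(1) by simp
  have gen: "\<exists>q\<in>carrier R. z = q \<otimes> y"
    if y: "y \<in> principal_ideal R w" "y \<noteq> \<zero>" and z: "z \<in> principal_ideal R w" for y z
  proof -
    obtain r where r: "r \<in> carrier R" "y = r \<otimes> w" using y(1) by blast
    obtain r' where r': "r' \<in> carrier R" "z = r' \<otimes> w" using z by blast
    have "r \<odot>\<^bsub>S\<^esub> x \<noteq> \<zero>\<^bsub>S\<^esub>" using ann[OF r(1)] r(2) y(2) by blast
    then obtain s where s: "s \<in> carrier R" "x = s \<odot>\<^bsub>S\<^esub> (r \<odot>\<^bsub>S\<^esub> x)"
      using S.simple_module_generate[OF assms(2) S.smult_closed[OF r(1) assms(3)] _ assms(3)] by metis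
    \<comment> \<open>Since x = srx, the element 1 - sr annihilates \<open>x\<close> and hence
      \<open>w\<close>. So w = srw = sy, and \<open>y\<close> generates Rw.\<close>
    have "(\<one> \<ominus> s \<otimes> r) \<odot>\<^bsub>S\<^esub> x = x \<ominus>\<^bsub>S\<^esub> s \<odot>\<^bsub>S\<^esub> (r \<odot>\<^bsub>S\<^esub> x)"
      using s(1) r(1) assms(3) by (simp add: S.smult_diff_l S.smult_assoc)
    also have "\<dots> = \<zero>\<^bsub>S\<^esub>"
      unfolding s(2)[symmetric] using assms(3) S.M.minus_eq_zero_iff by blast
    finally have "(\<one> \<ominus> s \<otimes> r) \<otimes> w = \<zero>" using ann[of "\<one> \<ominus> s \<otimes> r"] s(1) r(1) by simp
    then have "w \<ominus> s \<otimes> (r \<otimes> w) = \<zero>"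
      using s(1) r(1) w(1) by (simp add: minus_eq l_distr l_minus m_assoc)
    then have "w = s \<otimes> y" using minus_eq_zero_iff[of w "s \<otimes> (r \<otimes> w)"] s(1) r w(1) by simp
    then have "z = (r' \<otimes> s) \<otimes> y" using r' s(1) r w(1) by (simp add: m_assoc)
    then show ?thesis using r'(1) s(1) by blast
  qed
  have "simple_module R ((principal_module R (e t))\<lparr>carrier := principal_ideal R w\<rparr>)"
    unfolding W.simple_module_iff
  proof (intro conjI ballI)
    show "carrier ((principal_module R (e t))\<lparr>carrier := principal_ideal R w\<rparr>) \<noteq>
        {\<zero>\<^bsub>(principal_module R (e t))\<lparr>carrier := principal_ideal R w\<rparr>\<^esub>}"
      using self w(2) by (auto simp: principal_module_simps)
  qed (use gen in \<open>simp add: principal_module_simps\<close>)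
  then show ?thesis using sub by (simp add: simple_submodule_def)
qed

text \<open>Evaluation at \<open>x\<close> identifies \<open>Hom(S, R)\<close> with \<open>T\<close>.\<close>

lemma card_annihilated_le:
  assumes "left_module R S" "simple_module R S" "finite (carrier S)"
    and i: "i < m" and x: "x \<in> peirce S (e i)" "x \<noteq> \<zero>\<^bsub>S\<^esub>"
  defines "T \<equiv> {v \<in> carrier R. e i \<otimes> v = v \<and> (\<forall>r\<in>carrier R. r \<odot>\<^bsub>S\<^esub> x = \<zero>\<^bsub>S\<^esub> \<longrightarrow> r \<otimes> v = \<zero>)}"
  shows "card T \<le> card (carrier S)"
proof -
  interpret S: left_module R S by fact
  define q where "q = card (peirce S (e i))"
  have xS: "x \<in> carrier S" using x by (simp add: peirce_def)
  have q: "q \<ge> 1"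
    using x assms(3) by (auto simp: q_def peirce_def Suc_le_eq card_gt_0_iff)
  \<comment> \<open>The permutation acts on indices below \<open>k\<close> only, so
    \<open>e i\<close> is replaced by the representative of its class.\<close>
  obtain j where j: "j < k" "equiv_idem R (e i) (e j)" using representative[OF i] by blast
  have jm: "j < m" and \<pi>j: "\<pi> j < m"
    using j(1) k_le permutes_in_image[OF permutes, of j] by auto
  have TR: "T \<subseteq> carrier R" by (auto simp: T_def)
  have finT: "finite T" using TR finite_carrier by (rule finite_subset)
  have T_mult: "v \<otimes> r \<in> T" if "v \<in> T" "r \<in> carrier R" for v r
    using that e_closed[OF i] by (auto simp: T_def simp flip: m_assoc)
  \<comment> \<open>The part T e_l stands for Hom(S, R e_l), whose elements have image in the socle.
    It can be nontrivial only if that socle is of type \<open>S\<close>, which pins down the class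
    of \<open>e l\<close>.\<close>
  have bound: "card {w \<in> T. w \<otimes> e l = w} \<le> (if equiv_idem R (e (\<pi> j)) (e l) then q else 1)"
    if l: "l < m" for l
  proof -
    obtain t where t: "t < k" "equiv_idem R (e l) (e t)" using representative[OF l] by blast
    have tm: "t < m" using t(1) k_le by simp
    \<comment> \<open>The preimage of \<open>t\<close>, chosen so that the socle of R e_t is
      isomorphic to top(R e_p).\<close>
    obtain p where p: "p < k" "\<pi> p = t"
      using permutes_image[OF permutes] t(1) by (metis imageE lessThan_iff)
    have pm: "p < m" using p(1) k_le by simp
    let ?P = "principal_module R (e t)" and ?V = "top_module R (principal_module R (e p))"
    interpret P: left_module R ?P by (rule principal_left_module[OF e_closed[OF tm]])
    have soc_sub: "submodule (carrier (soc_module R ?P)) R ?P" by (rule P.soc_submodule)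
    have "?P\<lparr>carrier := carrier (soc_module R ?P)\<rparr> = soc_module R ?P" by (simp add: soc_module_def)
    then have soc_mod: "left_module R (soc_module R ?P)"
      using P.submodule_is_left_module[OF soc_sub] by simp
    note V = top_principal[OF finite_carrier primitive[OF pm]]
    interpret V: left_module R ?V by (rule V(1))
    have "w \<in> peirce (soc_module R ?P) (e i)" if w: "w \<in> T" "w \<otimes> e t = w" for w
    proof -
      have w': "w \<in> carrier R" "e i \<otimes> w = w"
        "\<And>r. \<lbrakk>r \<in> carrier R; r \<odot>\<^bsub>S\<^esub> x = \<zero>\<^bsub>S\<^esub>\<rbrakk> \<Longrightarrow> r \<otimes> w = \<zero>"
        using w(1) by (auto simp: T_def)
      have "w \<in> carrier (soc_module R ?P)"
      proof (cases "w = \<zero>")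
        case True
        then show ?thesis using P.submoduleD(2)[OF soc_sub] by (simp only: principal_module_simps)
      next
        case False
        have "simple_submodule (principal_ideal R w) R ?P"
          by (rule annihilated_simple[OF assms(1,2) xS w'(1) False w(2) tm w'(3)])
        moreover have "w \<in> principal_ideal R w"
          using left_module.self_in_cyclic[OF regular_left_module, of w] w'(1) by simp
        ultimately show ?thesis using P.simple_submodule_in_soc by blast
      qed
      then show ?thesis using w'(2) by (simp add: peirce_def soc_module_def principal_module_simps)
    qed
    then have sub: "{w \<in> T. w \<otimes> e t = w} \<subseteq> peirce (soc_module R ?P) (e i)" by blast
    have "carrier (soc_module R ?P) \<subseteq> carrier R"
    proof
      fix y assume "y \<in> carrier (soc_module R ?P)"
      then have "y \<in> principal_ideal R (e t)"
        using P.submoduleD(1)[OF soc_sub] unfolding principal_module_simps by blast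
      then show "y \<in> carrier R" using e_closed[OF tm] by auto
    qed
    then have "finite (peirce (soc_module R ?P) (e i))"
      using finite_carrier by (auto simp: peirce_def intro: finite_subset)
    then have "card {w \<in> T. w \<otimes> e t = w} \<le> card (peirce (soc_module R ?P) (e i))"
      using sub by (rule card_mono)
    also have "\<dots> = card (peirce ?V (e i))"
      by (rule module_iso_card_peirce[OF _ e_closed[OF i] soc_mod]) (use soc_iso_top[OF p(1)] p(2) in simp)
    also have "\<dots> \<le> (if equiv_idem R (e (\<pi> j)) (e l) then q else 1)"
    proof (cases "peirce ?V (e i) = {\<zero>\<^bsub>?V\<^esub>}")
      case True
      then show ?thesis using q by simp
    next
      case False
      then obtain v where v: "v \<in> peirce ?V (e i)" "v \<noteq> \<zero>\<^bsub>?V\<^esub>"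
        using V.zero_in_peirce[OF e_closed[OF i]] by blast
      obtain v' where v': "v' \<in> peirce ?V (e p)" "v' \<noteq> \<zero>\<^bsub>?V\<^esub>"
        using V(3) V.zero_in_peirce[OF e_closed[OF pm]] by blast
      have "equiv_idem R (e i) (e p)"
        by (rule V.simple_module_equiv_idem[OF V(2) finite_carrier primitive[OF i] primitive[OF pm] v v'])
      then have "equiv_idem R (e j) (e p)"
        using equiv_idem_trans[OF equiv_idem_sym[OF j(2)]] e_closed i jm pm by blast
      \<comment> \<open>Equivalent representatives below \<open>k\<close> coincide. Hence t =
        \<open>\<pi> j\<close>, so \<open>e l\<close> is equivalent to \<open>e (\<pi> j)\<close>
        whenever the socle of R e_t is not killed by \<open>e i\<close>.\<close>
      then have "j = p" using inequivalent j(1) p(1) by blast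
      then have "equiv_idem R (e (\<pi> j)) (e l)" using p(2) equiv_idem_sym[OF t(2)] by simp
      moreover have "module_iso R S ?V"
        by (rule simple_modules_iso[OF assms(1,2) V(1,2) finite_carrier primitive[OF i] x v])
      then have "q = card (peirce ?V (e i))"
        unfolding q_def by (rule module_iso_card_peirce[OF _ e_closed[OF i] assms(1)])
      ultimately show ?thesis by simp
    qed
    finally have bound_t: "card {w \<in> T. w \<otimes> e t = w} \<le> (if equiv_idem R (e (\<pi> j)) (e l) then q else 1)" .
    \<comment> \<open>The bound holds for the representative \<open>t\<close>. Right multiplication
      by \<open>a\<close> transfers it to \<open>l\<close>, embedding T e_l into T e_t with right
      multiplication by \<open>b\<close> as left inverse.\<close>
    obtain a b where ab: "a \<in> carrier R" "b \<in> carrier R" "a \<otimes> e t = a" "a \<otimes> b = e l"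
      using t(2) unfolding equiv_idem_def by blast
    have "card {w \<in> T. w \<otimes> e l = w} \<le> card {w \<in> T. w \<otimes> e t = w}"
    proof (rule card_inj_on_le[of "\<lambda>w. w \<otimes> a"])
      show "inj_on (\<lambda>w. w \<otimes> a) {w \<in> T. w \<otimes> e l = w}"
      proof (rule inj_on_inverseI[of _ "\<lambda>w. w \<otimes> b"])
        fix w assume "w \<in> {w \<in> T. w \<otimes> e l = w}"
        then show "(w \<otimes> a) \<otimes> b = w" using ab TR by (auto simp: m_assoc)
      qed
      show "(\<lambda>w. w \<otimes> a) ` {w \<in> T. w \<otimes> e l = w} \<subseteq> {w \<in> T. w \<otimes> e t = w}"
      proof (rule image_subsetI)
        fix w assume "w \<in> {w \<in> T. w \<otimes> e l = w}"
        then have w: "w \<in> T" "w \<in> carrier R" using TR by auto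
        have "(w \<otimes> a) \<otimes> e t = w \<otimes> a" using w(2) ab e_closed[OF tm] by (simp add: m_assoc)
        then show "w \<otimes> a \<in> {w \<in> T. w \<otimes> e t = w}" using T_mult[OF w(1) ab(1)] by simp
      qed
      show "finite {w \<in> T. w \<otimes> e t = w}" using finT by simp
    qed
    then show ?thesis using bound_t by (rule order_trans)
  qed
  have class_eq: "{l. l < m \<and> equiv_idem R (e i) (e l)} = {l. l < m \<and> equiv_idem R (e j) (e l)}"
    using equiv_idem_trans[OF j(2)] equiv_idem_trans[OF equiv_idem_sym[OF j(2)]] e_closed i jm by blast
  have "card T \<le> (\<Prod>l<m. card {w \<in> T. w \<otimes> e l = w})"
    by (rule card_le_prod_components[OF TR T_mult])
  also have "\<dots> \<le> (\<Prod>l<m. if equiv_idem R (e (\<pi> j)) (e l) then q else 1)"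
    by (rule prod_mono) (use bound in simp)
  also have "\<dots> = (\<Prod>l\<in>{l \<in> {..<m}. equiv_idem R (e (\<pi> j)) (e l)}. q)"
    by (rule prod.inter_filter[symmetric]) simp
  also have "\<dots> = q ^ card {l. l < m \<and> equiv_idem R (e (\<pi> j)) (e l)}" by simp
  \<comment> \<open>Equality of multiplicities enters here: the exponent from the socle side, the
    class of \<open>e (\<pi> j)\<close>, is exchanged for the class of \<open>e j\<close>, which is
    that of \<open>e i\<close>.\<close>
  also have "\<dots> = q ^ card {l. l < m \<and> equiv_idem R (e i) (e l)}"
    using card_class[OF j(1)] class_eq by simp
  also have "\<dots> \<le> card (carrier S)" unfolding q_def by (rule card_ge_power[OF assms(1,3) i])
  finally show ?thesis .
qed

end

subsection \<open>Codes and their duals\<close>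

lemma free_module_simps:
  "carrier (free_module R n) = (\<Pi>\<^sub>E i\<in>{..<n}. carrier R)"
  "\<zero>\<^bsub>free_module R n\<^esub> = (\<lambda>i\<in>{..<n}. \<zero>\<^bsub>R\<^esub>)"
  "x \<oplus>\<^bsub>free_module R n\<^esub> y = (\<lambda>i\<in>{..<n}. x i \<oplus>\<^bsub>R\<^esub> y i)"
  "r \<odot>\<^bsub>free_module R n\<^esub> x = (\<lambda>i\<in>{..<n}. r \<otimes>\<^bsub>R\<^esub> x i)"
  by (simp_all add: free_module_def)

context ring
begin

lemma free_left_module: "left_module R (free_module R n)"
proof -
  note simps = free_module_simps
  have "abelian_group (free_module R n)"
  proof (rule abelian_groupI)
    fix x assume x: "x \<in> carrier (free_module R n)"
    show "\<exists>y\<in>carrier (free_module R n). y \<oplus>\<^bsub>free_module R n\<^esub> x = \<zero>\<^bsub>free_module R n\<^esub>"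
    proof (rule bexI)
      show "(\<lambda>i\<in>{..<n}. \<ominus> x i) \<oplus>\<^bsub>free_module R n\<^esub> x = \<zero>\<^bsub>free_module R n\<^esub>"
        using x by (auto simp: simps PiE_iff l_neg intro!: restrict_ext)
      show "(\<lambda>i\<in>{..<n}. \<ominus> x i) \<in> carrier (free_module R n)"
        using x by (auto simp: simps PiE_iff)
    qed
  next
    fix x assume "x \<in> carrier (free_module R n)"
    then show "\<zero>\<^bsub>free_module R n\<^esub> \<oplus>\<^bsub>free_module R n\<^esub> x = x"
      by (intro ext) (auto simp: simps PiE_iff extensional_def)
  qed (auto simp: simps PiE_iff a_ac intro!: restrict_ext)
  moreover have "\<one> \<odot>\<^bsub>free_module R n\<^esub> x = x" if "x \<in> carrier (free_module R n)" for x
    using that by (intro ext) (auto simp: simps PiE_iff extensional_def)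
  ultimately show ?thesis
    by (intro left_module.intro left_module_axioms.intro)
      (auto simp: ring_axioms simps PiE_iff l_distr r_distr m_assoc intro!: restrict_ext)
qed

context
  fixes n :: nat
begin

interpretation F: left_module R "free_module R n" by (rule free_left_module)

lemma vec_nth_closed: "\<lbrakk>x \<in> carrier (free_module R n); i < n\<rbrakk> \<Longrightarrow> x i \<in> carrier R"
  by (auto simp: free_module_simps)

lemma vec_prod_closed: "\<lbrakk>x \<in> carrier (free_module R n); y \<in> carrier (free_module R n)\<rbrakk> \<Longrightarrow> vec_prod R n x y \<in> carrier R"
  unfolding vec_prod_def by (rule finsum_closed) (auto simp: vec_nth_closed)

lemma vec_prod_add_left:
  assumes "x \<in> carrier (free_module R n)" "y \<in> carrier (free_module R n)" "z \<in> carrier (free_module R n)"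
  shows "vec_prod R n (x \<oplus>\<^bsub>free_module R n\<^esub> y) z = vec_prod R n x z \<oplus> vec_prod R n y z"
proof -
  have "vec_prod R n (x \<oplus>\<^bsub>free_module R n\<^esub> y) z = (\<Oplus>i\<in>{..<n}. x i \<otimes> z i \<oplus> y i \<otimes> z i)"
    unfolding vec_prod_def
    by (rule finsum_cong') (use assms in \<open>auto simp: free_module_simps(3) vec_nth_closed l_distr\<close>)
  also have "\<dots> = vec_prod R n x z \<oplus> vec_prod R n y z"
    unfolding vec_prod_def by (rule finsum_addf) (use assms in \<open>auto simp: vec_nth_closed\<close>)
  finally show ?thesis .
qed

lemma vec_prod_add_right:
  assumes "x \<in> carrier (free_module R n)" "y \<in> carrier (free_module R n)" "z \<in> carrier (free_module R n)"
  shows "vec_prod R n x (y \<oplus>\<^bsub>free_module R n\<^esub> z) = vec_prod R n x y \<oplus> vec_prod R n x z"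
proof -
  have "vec_prod R n x (y \<oplus>\<^bsub>free_module R n\<^esub> z) = (\<Oplus>i\<in>{..<n}. x i \<otimes> y i \<oplus> x i \<otimes> z i)"
    unfolding vec_prod_def
    by (rule finsum_cong') (use assms in \<open>auto simp: free_module_simps(3) vec_nth_closed r_distr\<close>)
  also have "\<dots> = vec_prod R n x y \<oplus> vec_prod R n x z"
    unfolding vec_prod_def by (rule finsum_addf) (use assms in \<open>auto simp: vec_nth_closed\<close>)
  finally show ?thesis .
qed

lemma vec_prod_smult:
  assumes "r \<in> carrier R" "x \<in> carrier (free_module R n)" "y \<in> carrier (free_module R n)"
  shows "vec_prod R n (r \<odot>\<^bsub>free_module R n\<^esub> x) y = r \<otimes> vec_prod R n x y"
proof -
  have "vec_prod R n (r \<odot>\<^bsub>free_module R n\<^esub> x) y = (\<Oplus>i\<in>{..<n}. r \<otimes> (x i \<otimes> y i))"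
    unfolding vec_prod_def
    by (rule finsum_cong') (use assms in \<open>auto simp: free_module_simps(4) vec_nth_closed m_assoc\<close>)
  also have "\<dots> = r \<otimes> vec_prod R n x y"
    unfolding vec_prod_def
    by (rule finsum_rdistr[symmetric]) (use assms in \<open>auto simp: vec_nth_closed\<close>)
  finally show ?thesis .
qed

lemma vec_prod_zero_left:
  assumes "y \<in> carrier (free_module R n)"
  shows "vec_prod R n \<zero>\<^bsub>free_module R n\<^esub> y = \<zero>"
  using vec_prod_smult[OF zero_closed F.M.zero_closed assms] vec_prod_closed[OF F.M.zero_closed assms]
  by simp

lemma vec_prod_eqD:
  assumes "x \<in> carrier (free_module R n)" "y \<in> carrier (free_module R n)" "z \<in> carrier (free_module R n)" "vec_prod R n x y = vec_prod R n x z"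
  shows "vec_prod R n x (y \<ominus>\<^bsub>free_module R n\<^esub> z) = \<zero>"
proof -
  have "y = (y \<ominus>\<^bsub>free_module R n\<^esub> z) \<oplus>\<^bsub>free_module R n\<^esub> z"
    using assms by (simp add: F.M.minus_eq F.M.a_assoc F.M.l_neg)
  then have "vec_prod R n x y = vec_prod R n x (y \<ominus>\<^bsub>free_module R n\<^esub> z) \<oplus> vec_prod R n x z"
    using vec_prod_add_right[OF assms(1) F.M.minus_closed[OF assms(2,3)] assms(3)] by simp
  then show ?thesis
    using assms(4) vec_prod_closed[OF assms(1,3)]
      vec_prod_closed[OF assms(1) F.M.minus_closed[OF assms(2,3)]]
    by simp
qed

lemma dual_code_subgroup:
  assumes "C \<subseteq> carrier (free_module R n)"
  shows "subgroup (dual_code R n C) (add_monoid (free_module R n))"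
proof (rule F.M.add.subgroupI[simplified])
  \<comment> \<open>Obtained from 0 = 0 - 0 by linearity in the second argument.\<close>
  have zero: "vec_prod R n c \<zero>\<^bsub>free_module R n\<^esub> = \<zero>" if "c \<in> carrier (free_module R n)" for c
    using vec_prod_eqD[OF that F.M.zero_closed F.M.zero_closed] by (simp add: F.M.minus_eq F.M.r_neg)
  show "dual_code R n C \<subseteq> carrier (free_module R n)" by (auto simp: dual_code_def)
  have "\<zero>\<^bsub>free_module R n\<^esub> \<in> dual_code R n C" using zero assms by (auto simp: dual_code_def)
  then show "dual_code R n C \<noteq> {}" by blast
  fix s assume s: "s \<in> dual_code R n C"
  then have sV: "s \<in> carrier (free_module R n)" by (simp add: dual_code_def)
  have neg: "\<zero>\<^bsub>free_module R n\<^esub> \<ominus>\<^bsub>free_module R n\<^esub> s = \<ominus>\<^bsub>free_module R n\<^esub> s"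
    using sV by (simp add: F.M.minus_eq)
  have "vec_prod R n c (\<ominus>\<^bsub>free_module R n\<^esub> s) = \<zero>" if c: "c \<in> C" for c
    using vec_prod_eqD[OF _ F.M.zero_closed sV, of c] zero[of c] c s assms
    by (auto simp: neg dual_code_def)
  then show "\<ominus>\<^bsub>free_module R n\<^esub> s \<in> dual_code R n C" using sV by (simp add: dual_code_def)
  fix t assume t: "t \<in> dual_code R n C"
  have "vec_prod R n c (s \<oplus>\<^bsub>free_module R n\<^esub> t) = \<zero>" if c: "c \<in> C" for c
    using vec_prod_add_right[of c s t] c s t assms by (auto simp: dual_code_def)
  then show "s \<oplus>\<^bsub>free_module R n\<^esub> t \<in> dual_code R n C"
    using s t by (simp add: dual_code_def)
qed

end

end

lemma card_le_fibres:
  assumes "finite B" "g ` A \<subseteq> B" "\<And>b. b \<in> B \<Longrightarrow> card {a \<in> A. g a = b} \<le> d"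
  shows "card A \<le> card B * d"
proof -
  have "A = (\<Union>b\<in>B. {a \<in> A. g a = b})" using assms(2) by blast
  then have "card A \<le> (\<Sum>b\<in>B. card {a \<in> A. g a = b})"
    using card_UN_le[OF assms(1), of "\<lambda>b. {a \<in> A. g a = b}"] by simp
  also have "\<dots> \<le> (\<Sum>b\<in>B. d)" using assms(3) by (rule sum_mono)
  finally show ?thesis by simp
qed

context frobenius_decomposition
begin

lemma card_code_dual:
  assumes "submodule C R (free_module R n)"
  shows "card (carrier (free_module R n)) \<le> card C * card (dual_code R n C)"
  using assms
proof (induction "card C" arbitrary: C rule: less_induct)
  case less
  let ?F = "free_module R n"
  interpret F: left_module R ?F by (rule free_left_module)
  have finF: "finite (carrier ?F)"
    unfolding free_module_simps by (rule finite_PiE) (simp_all add: finite_carrier)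
  note C = F.submoduleD[OF less.prems]
  have finC: "finite C" using C(1) finF by (rule finite_subset)
  show ?case
  proof (cases "C = {\<zero>\<^bsub>?F\<^esub>}")
    case True
    then have "dual_code R n C = carrier ?F" by (auto simp: dual_code_def vec_prod_zero_left)
    then show ?thesis using True by simp
  next
    case False
    let ?M = "?F\<lparr>carrier := C\<rparr>"
    interpret M: left_module R ?M by (rule F.submodule_is_left_module[OF less.prems])
    obtain N where max: "maximal_submodule N R ?M"
      using M.exists_maximal_submodule[OF _ M.submodule_zero] finC False by auto
    then have sub: "submodule N R ?M" "N \<noteq> C" by (auto simp: maximal_submodule_def)
    have NF: "submodule N R ?F" "N \<subseteq> C"
      using F.submodule_of_submodule_iff[OF less.prems] sub(1) by auto
    have IH: "card (carrier ?F) \<le> card N * card (dual_code R n N)"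
      by (rule less.hyps) (use NF sub(2) finC in \<open>auto intro: psubset_card_mono\<close>)
    let ?S = "quot_module ?M N"
    have S: "left_module R ?S" "simple_module R ?S"
      by (rule M.quot_module_is_left_module[OF sub(1)], rule M.quot_module_simple[OF max])
    interpret S: left_module R ?S by (rule S(1))
    have finS: "finite (carrier ?S)" using finC by (simp add: M.quot_module_simps)
    obtain X0 where "X0 \<in> carrier ?S" "X0 \<noteq> \<zero>\<^bsub>?S\<^esub>"
      using S(2) S.M.zero_closed unfolding simple_module_def by blast
    then obtain i where i: "i < m" "e i \<odot>\<^bsub>?S\<^esub> X0 \<noteq> \<zero>\<^bsub>?S\<^esub>" and X0: "X0 \<in> carrier ?S"
      using exists_component[OF S(1)] by metis
    obtain c0 where c0: "c0 \<in> C" "X0 = N +>\<^bsub>?M\<^esub> c0" using X0 by (auto simp: M.quot_module_simps)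
    \<comment> \<open>Multiplication by \<open>e i\<close> moves the representative so that its
      class is a nonzero element of e_i S. That class generates the simple quotient, so C = Rc +
      N.\<close>
    define c where "c = e i \<odot>\<^bsub>?F\<^esub> c0"
    have c: "c \<in> C" "e i \<odot>\<^bsub>?F\<^esub> c = c"
      using C(1,4) c0(1) e_closed[OF i(1)] e_idem[OF i(1)]
      by (auto simp: c_def subset_iff simp flip: F.smult_assoc)
    define X where "X = N +>\<^bsub>?M\<^esub> c"
    have smult_X: "r \<odot>\<^bsub>?S\<^esub> X = N +>\<^bsub>?M\<^esub> (r \<odot>\<^bsub>?F\<^esub> c)" if "r \<in> carrier R" for r
      using M.quot_module_smult[OF sub(1) that, of c] c(1) by (simp add: X_def)
    have X_eq: "X = e i \<odot>\<^bsub>?S\<^esub> X0"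
      using M.quot_module_smult[OF sub(1) e_closed[OF i(1)], of c0] c0 by (simp add: X_def c_def)
    have X: "X \<in> peirce ?S (e i)" "X \<noteq> \<zero>\<^bsub>?S\<^esub>"
      using X_eq i(2) smult_X[OF e_closed[OF i(1)]] c
      by (simp_all add: peirce_def M.quot_module_simps) (auto simp: X_def)
    have ann_X: "r \<odot>\<^bsub>?S\<^esub> X = \<zero>\<^bsub>?S\<^esub> \<longleftrightarrow> r \<odot>\<^bsub>?F\<^esub> c \<in> N" if "r \<in> carrier R" for r
      using M.coset_eq_zero_iff[OF sub(1), of "r \<odot>\<^bsub>?F\<^esub> c"] smult_X[OF that] C(4)[OF that c(1)]
      by (simp add: M.quot_module_simps)
    have cN: "c \<notin> N"
      using M.coset_eq_zero_iff[OF sub(1), of c] X(2) c(1) by (simp add: X_def M.quot_module_simps)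
    have cF: "c \<in> carrier ?F" using c(1) C(1) by blast
    define T where "T = {v \<in> carrier R. e i \<otimes> v = v \<and> (\<forall>r\<in>carrier R. r \<odot>\<^bsub>?S\<^esub> X = \<zero>\<^bsub>?S\<^esub> \<longrightarrow> r \<otimes> v = \<zero>)}"
    have cardT: "card T \<le> card (carrier ?S)"
      unfolding T_def by (rule card_annihilated_le[OF S finS i(1) X])
    have finT: "finite T" using finite_carrier by (simp add: T_def)
    have dualF: "dual_code R n D \<subseteq> carrier ?F" for D by (auto simp: dual_code_def)
    \<comment> \<open>The map s \<mapsto> cs sends the dual of \<open>N\<close> into
      \<open>T\<close>, because rX = 0 means that rc lies in \<open>N\<close>. Two members of one
      fibre differ by an element of the dual of \<open>C\<close>, so each fibre is no larger than
      that dual.\<close>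
    have "card (dual_code R n N) \<le> card T * card (dual_code R n C)"
    proof (rule card_le_fibres[OF finT, of "vec_prod R n c"])
      show "vec_prod R n c ` dual_code R n N \<subseteq> T"
      proof (rule image_subsetI)
        fix s assume s: "s \<in> dual_code R n N"
        then have sF: "s \<in> carrier ?F" using dualF by blast
        have "r \<otimes> vec_prod R n c s = \<zero>" if "r \<in> carrier R" "r \<odot>\<^bsub>?S\<^esub> X = \<zero>\<^bsub>?S\<^esub>" for r
          using that ann_X vec_prod_smult[OF that(1) cF sF] s by (auto simp: dual_code_def)
        then show "vec_prod R n c s \<in> T"
          using vec_prod_smult[OF e_closed[OF i(1)] cF sF] vec_prod_closed[OF cF sF] c(2) by (simp add: T_def)
      qed
      fix v assume "v \<in> T"
      let ?A = "{s \<in> dual_code R n N. vec_prod R n c s = v}"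
      show "card ?A \<le> card (dual_code R n C)"
      proof (cases "?A = {}")
        case False
        then obtain t where t: "t \<in> dual_code R n N" "vec_prod R n c t = v" by blast
        then have tF: "t \<in> carrier ?F" using dualF by blast
        show ?thesis
        proof (rule card_inj_on_le[of "\<lambda>s. s \<ominus>\<^bsub>?F\<^esub> t"])
          show "inj_on (\<lambda>s. s \<ominus>\<^bsub>?F\<^esub> t) ?A"
          proof (rule inj_on_inverseI[of _ "\<lambda>s. s \<oplus>\<^bsub>?F\<^esub> t"])
            fix s assume "s \<in> ?A"
            then have "s \<in> carrier ?F" using dualF by blast
            then show "(s \<ominus>\<^bsub>?F\<^esub> t) \<oplus>\<^bsub>?F\<^esub> t = s"
              using tF by (simp add: F.M.minus_eq F.M.a_assoc F.M.l_neg)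
          qed
          show "(\<lambda>s. s \<ominus>\<^bsub>?F\<^esub> t) ` ?A \<subseteq> dual_code R n C"
          proof (rule image_subsetI)
            fix s assume s: "s \<in> ?A"
            then have sF: "s \<in> carrier ?F" using dualF by blast
            have "vec_prod R n d (s \<ominus>\<^bsub>?F\<^esub> t) = \<zero>" if d: "d \<in> C" for d
            proof (rule vec_prod_eqD[OF _ sF tF])
              show "d \<in> carrier ?F" using d C(1) by blast
              obtain r h where r: "r \<in> carrier R" "h \<in> N" "d = r \<odot>\<^bsub>?M\<^esub> c \<oplus>\<^bsub>?M\<^esub> h"
                using M.maximal_submodule_generate[OF max _ cN, of d] c(1) d by auto
              have hF: "h \<in> carrier ?F" using r(2) NF(2) C(1) by blast
              have rc: "r \<odot>\<^bsub>?F\<^esub> c \<in> carrier ?F" using r(1) cF by simp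
              \<comment> \<open>With d = rc + h and h in \<open>N\<close>, the product of d with a
                member of the fibre depends only on the common value \<open>v\<close>.\<close>
              have "vec_prod R n d u = r \<otimes> v" if u: "u \<in> ?A" for u
              proof -
                have uF: "u \<in> carrier ?F" using u dualF by blast
                have "vec_prod R n d u = r \<otimes> vec_prod R n c u \<oplus> vec_prod R n h u"
                  using r(3) vec_prod_add_left[OF rc hF uF] vec_prod_smult[OF r(1) cF uF] by simp
                then show ?thesis using u r(1,2) vec_prod_closed[OF cF uF] by (auto simp: dual_code_def)
              qed
              then show "vec_prod R n d s = vec_prod R n d t" using s t by simp
            qed
            then show "s \<ominus>\<^bsub>?F\<^esub> t \<in> dual_code R n C" using sF tF by (simp add: dual_code_def)
          qed
          show "finite (dual_code R n C)" using dualF finF by (rule finite_subset)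
        qed
      next
        case True
        then show ?thesis by (simp only: card.empty)
      qed
    qed
    also have "\<dots> \<le> card (carrier ?S) * card (dual_code R n C)" using cardT by simp
    finally have "card N * card (dual_code R n N) \<le> card N * (card (carrier ?S) * card (dual_code R n C))"
      by simp
    also have "\<dots> = card C * card (dual_code R n C)"
      using M.card_submodule_quotient[OF sub(1)] finC by simp
    finally show ?thesis using IH by simp
  qed
qed

lemma lcd_code_direct_summand:
  assumes "left_lcd_code R n C"
  shows "direct_summand C (add_monoid (free_module R n))"
proof -
  let ?F = "free_module R n" and ?D = "dual_code R n C"
  interpret F: left_module R ?F by (rule free_left_module)
  have sub: "submodule C R ?F" and int: "C \<inter> ?D = {\<zero>\<^bsub>?F\<^esub>}"
    using assms by (auto simp: left_lcd_code_def left_code_def)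
  note C = F.submoduleD[OF sub]
  have finF: "finite (carrier ?F)"
    unfolding free_module_simps by (rule finite_PiE) (simp_all add: finite_carrier)
  have D: "subgroup ?D (add_monoid ?F)" by (rule dual_code_subgroup[OF C(1)])
  have DF: "?D \<subseteq> carrier ?F" by (auto simp: dual_code_def)
  let ?f = "\<lambda>(c, d). c \<oplus>\<^bsub>?F\<^esub> d"
  have "inj_on ?f (C \<times> ?D)"
  proof (rule inj_onI, clarify)
    fix c d c' d' assume cd: "c \<in> C" "d \<in> ?D" "c' \<in> C" "d' \<in> ?D" "c \<oplus>\<^bsub>?F\<^esub> d = c' \<oplus>\<^bsub>?F\<^esub> d'"
    then have carr: "c \<in> carrier ?F" "d \<in> carrier ?F" "c' \<in> carrier ?F" "d' \<in> carrier ?F"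
      using C(1) DF by auto
    have "c \<ominus>\<^bsub>?F\<^esub> c' = (c \<oplus>\<^bsub>?F\<^esub> d) \<oplus>\<^bsub>?F\<^esub> (\<ominus>\<^bsub>?F\<^esub> d \<oplus>\<^bsub>?F\<^esub> \<ominus>\<^bsub>?F\<^esub> c')"
      using carr by (simp add: F.M.minus_eq F.M.a_assoc F.M.r_neg2)
    also have "\<dots> = (c' \<oplus>\<^bsub>?F\<^esub> d') \<oplus>\<^bsub>?F\<^esub> (\<ominus>\<^bsub>?F\<^esub> d \<oplus>\<^bsub>?F\<^esub> \<ominus>\<^bsub>?F\<^esub> c')" by (simp only: cd(5))
    also have "\<dots> = (d' \<oplus>\<^bsub>?F\<^esub> c') \<oplus>\<^bsub>?F\<^esub> (\<ominus>\<^bsub>?F\<^esub> c' \<oplus>\<^bsub>?F\<^esub> \<ominus>\<^bsub>?F\<^esub> d)"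
      using carr by (simp add: F.M.a_comm)
    also have "\<dots> = d' \<ominus>\<^bsub>?F\<^esub> d"
      using carr by (simp add: F.M.minus_eq F.M.a_assoc F.M.r_neg2)
    finally have eq: "c \<ominus>\<^bsub>?F\<^esub> c' = d' \<ominus>\<^bsub>?F\<^esub> d" .
    have "d' \<ominus>\<^bsub>?F\<^esub> d \<in> ?D"
      using subgroup.m_closed[OF D cd(4) subgroup.m_inv_closed[OF D cd(2)]]
      by (simp add: F.M.minus_eq a_inv_def)
    moreover have "c \<ominus>\<^bsub>?F\<^esub> c' \<in> C" by (rule C(6)[OF cd(1,3)])
    ultimately have "c \<ominus>\<^bsub>?F\<^esub> c' = \<zero>\<^bsub>?F\<^esub>" "d' \<ominus>\<^bsub>?F\<^esub> d = \<zero>\<^bsub>?F\<^esub>" using eq int by auto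
    then show "c = c' \<and> d = d'" using F.M.minus_eq_zero_iff carr by auto
  qed
  then have "card (?f ` (C \<times> ?D)) = card C * card ?D" by (simp add: card_image card_cartesian_product)
  then have "card (carrier ?F) \<le> card (?f ` (C \<times> ?D))" using card_code_dual[OF sub] by simp
  moreover have "?f ` (C \<times> ?D) \<subseteq> carrier ?F" using C(1) DF by auto
  ultimately have "?f ` (C \<times> ?D) = carrier ?F" using finF by (intro card_seteq)
  moreover have "C <#>\<^bsub>add_monoid ?F\<^esub> ?D = ?f ` (C \<times> ?D)" by (auto simp: set_mult_def)
  ultimately have "C <#>\<^bsub>add_monoid ?F\<^esub> ?D = carrier (add_monoid ?F)" by simp
  then show ?thesis
    using D int submodule.axioms(1)[OF sub] unfolding direct_summand_def by auto
qed

end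

text \<open>Multiplicities are defined for right modules, so \<open>multiplicity_in_top\<close> is applied to \<open>opp_ring R\<close>.\<close>

lemma frobenius_ring_decomposition:
  assumes "finite (carrier R)" "frobenius_ring R"
  obtains m e k \<pi> where "frobenius_decomposition R m e k \<pi>"
proof -
  interpret ring R using assms(2) by (simp add: frobenius_ring_def quasi_frobenius_ring_def)
  interpret O: ring "opp_ring R" by (rule ring_opp_ring)
  obtain m k e \<pi> where ord: "ordered_primitive_idempotents R m k e"
    and nak: "nakayama_permutation R k e \<pi>"
    and mult: "\<forall>i<k. top_multiplicity R (e i) = top_multiplicity R (e (\<pi> i))"
    using assms(2) unfolding frobenius_ring_def by (elim conjE exE) rule
  note ord = ord[unfolded ordered_primitive_idempotents_def]
  note nak = nak[unfolded nakayama_permutation_def]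
  have prim: "primitive_idempotent R (e i)" if "i < m" for i using ord that by blast
  interpret D: primitive_decomposition R m e
    by unfold_locales (use assms(1) ord in \<open>auto simp: orthogonal_in_def\<close>)
  \<comment> \<open>Orthogonality is symmetric, so the same idempotents decompose the opposite ring,
    where \<open>top_multiplicity\<close> is computed.\<close>
  interpret OD: primitive_decomposition "opp_ring R" m e
    by unfold_locales (use assms(1) ord D.orthogonal in \<open>auto simp: D.sum_one\<close>)
  have k: "k \<le> m" using ord by blast
  have iso_iff: "module_iso (opp_ring R) (principal_module (opp_ring R) (e i))
      (principal_module (opp_ring R) (e j)) \<longleftrightarrow> equiv_idem R (e i) (e j)" if "i < m" "j < m" for i j
    using O.principal_modules_iso_iff[of "e i" "e j"] prim that by simp
  have perm: "\<pi> permutes {..<k}" using nak by blast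
  \<comment> \<open>The count is carried out over \<open>opp_ring R\<close>;
    \<open>equiv_idem_opp_ring\<close> brings the resulting class back to \<open>R\<close>.\<close>
  have mult_eq: "top_multiplicity R (e i) = card {l. l < m \<and> equiv_idem R (e i) (e l)}" if "i < m" for i
    using OD.multiplicity_in_top[OF that] by (simp add: top_multiplicity_def)
  have "frobenius_decomposition R m e k \<pi>"
  proof unfold_locales
    show "i = j" if "i < k" "j < k" "equiv_idem R (e i) (e j)" for i j
      using ord iso_iff[of i j] that k by (meson less_le_trans)
    show "\<exists>j<k. equiv_idem R (e i) (e j)" if i: "i < m" for i
    proof (cases "i < k")
      case True
      then show ?thesis using equiv_idem_refl[OF prim[OF i]] by blast
    next
      case False
      then obtain j where "j < k" "module_iso (opp_ring R) (principal_module (opp_ring R) (e i))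
          (principal_module (opp_ring R) (e j))"
        using ord i by (meson not_less)
      then show ?thesis using iso_iff[OF i, of j] k by auto
    qed
    show "module_iso R (soc_module R (principal_module R (e (\<pi> i)))) (top_module R (principal_module R (e i)))"
      if "i < k" for i using nak that by blast
    show "card {l. l < m \<and> equiv_idem R (e i) (e l)} = card {l. l < m \<and> equiv_idem R (e (\<pi> i)) (e l)}"
      if i: "i < k" for i
    proof -
      have "\<pi> i < k" using permutes_in_image[OF perm, of i] i by simp
      then show ?thesis using mult i k mult_eq[of i] mult_eq[of "\<pi> i"] by simp
    qed
  qed (use k perm in auto)
  then show thesis by (rule that)
qed

theorem lemma16:
  fixes R :: "('a, 'r) ring_scheme" and n :: nat and C :: "(nat \<Rightarrow> 'a) set"
  assumes "finite (carrier R)"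
    and "frobenius_ring R"
    and "n > 0"
    and "left_lcd_code R n C"
  shows "direct_summand C (add_monoid (free_module R n))"
proof -
  obtain m e k \<pi> where "frobenius_decomposition R m e k \<pi>"
    using frobenius_ring_decomposition[OF assms(1,2)] .
  then interpret frobenius_decomposition R m e k \<pi> .
  show ?thesis using assms(4) by (rule lcd_code_direct_summand)
qed

end
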